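(* Let $n \geq d \geq 2$ be integers and let $1<\alpha_1<\dots<\alpha_{d-1}$ be integers, $\alpha=(\alpha_1,\dots,\alpha_{d-1})$. Then the boundary $\operatorname{bd}\Pi_{n,\alpha}$ of $\Pi_{n,\alpha}$ in $\mathbb{R}^{d-1}$ is the closure of the set of all values $\nu_{n,\alpha}(x)$, where $x$ ranges over the points of $\Delta_{n-1}$ of multiplicity length equal to $d-1$ and of type (1) or type (2). Moreover, the pre-image in $\Delta_{n-1}$ under $\nu_{n,\alpha}$ of any point of $\operatorname{bd}\Pi_{n,\alpha}$ is unique up to permutation of coordinates.
   Context: $\Delta_{n-1}=\{x\in\mathbb{R}^n_{\geq 0}: x_1+\dots+x_n=1\}$. For a positive integer $a$, $p_a(x)=x_1^a+\dots+x_n^a$. The map $\nu_{n,\alpha}$ is $x\mapsto (p_{\alpha_1}(x),\dots,p_{\alpha_{d-1}}(x))\in\mathbb{R}^{d-1}$ and $\Pi_{n,\alpha}=\nu_{n,\alpha}(\Delta_{n-1})$. Multiplicity and types: let $x\in\mathbb{R}^n_{\geq 0}$ have nondecreasing coordinates $x_1\le\dots\le x_n$ and let $0<y_1<\dots<y_\ell$ be its distinct positive coordinates. Let $m_i\ge 1$ be the number of coordinates of $x$ equal to $y_i$ ($1\le i\le \ell$) and $m_0\ge 0$ the number of coordinates equal to $0$. The vector $(m_0,m_1,\dots,m_\ell)$ is the multiplicity vector of $x$ and $\ell$ is its multiplicity length. The point $x$ is of type (1) if $m_0\ge 0$, and for all $i\ge1$ (with index at most $\ell$) $m_{2i-1}=1$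 and $m_{2i}\ge 1$. The point $x$ is of type (2) if $m_0=0$, and for all $i\ge 1$ (with index at most $\ell$) $m_{2i-1}\ge 1$ and $m_{2i}=1$. *)

theory Defs
  imports "HOL-Analysis.Analysis"
begin

definition std_simplex :: "(real ^ 'n) set" where
  "std_simplex = {x. (\<forall>i. 0 \<le> x $ i) \<and> (\<Sum>i\<in>UNIV. x $ i) = 1}"

definition power_sum :: "nat \<Rightarrow> real ^ 'n \<Rightarrow> real" where
  "power_sum a x = (\<Sum>i\<in>UNIV. (x $ i) ^ a)"

text \<open>The exponent vector is a family indexed by the same type as the coordinates of the target
  space. When that index type carries a linear order, being strictly increasing is
  \<^term>\<open>strict_mono\<close>.\<close>

definition vandermonde_map :: "('m \<Rightarrow> nat) \<Rightarrow> real ^ 'n \<Rightarrow> real ^ 'm" where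
  "vandermonde_map \<alpha> x = (\<chi> j. power_sum (\<alpha> j) x)"

definition pos_values :: "real ^ 'n \<Rightarrow> real set" where
  "pos_values x = {v. v > 0 \<and> (\<exists>i. x $ i = v)}"

definition mult_length :: "real ^ 'n \<Rightarrow> nat" where
  "mult_length x = card (pos_values x)"

text \<open>The list \<open>[m\<^sub>0, m\<^sub>1, \<dots>, m\<^sub>\<ell>]\<close>, where \<open>m\<^sub>0\<close> counts the zero coordinates and \<open>m\<^sub>k\<close> the
  coordinates equal to the \<open>k\<close>-th smallest positive value. Multiplicities do not depend on the order
  of the coordinates, so \<open>x\<close> is not required to be sorted.\<close>

definition mult_vector :: "real ^ 'n \<Rightarrow> nat list" where
  "mult_vector x = map (\<lambda>v. card {i. x $ i = v}) (0 # sorted_list_of_set (pos_values x))"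

definition type_1 :: "real ^ 'n \<Rightarrow> bool" where
  "type_1 x \<longleftrightarrow> mult_vector x ! 0 \<ge> 0 \<and>
     (\<forall>i\<ge>1. (2 * i - 1 \<le> mult_length x \<longrightarrow> mult_vector x ! (2 * i - 1) = 1) \<and>
            (2 * i \<le> mult_length x \<longrightarrow> mult_vector x ! (2 * i) \<ge> 1))"

definition type_2 :: "real ^ 'n \<Rightarrow> bool" where
  "type_2 x \<longleftrightarrow> mult_vector x ! 0 = 0 \<and>
     (\<forall>i\<ge>1. (2 * i - 1 \<le> mult_length x \<longrightarrow> mult_vector x ! (2 * i - 1) \<ge> 1) \<and>
            (2 * i \<le> mult_length x \<longrightarrow> mult_vector x ! (2 * i) = 1))"

definition permuted :: "real ^ 'n \<Rightarrow> real ^ 'n \<Rightarrow> bool" where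
  "permuted x y \<longleftrightarrow> (\<exists>\<sigma>. \<sigma> permutes UNIV \<and> y = (\<chi> i. x $ \<sigma> i))"

end

theory Submission
  imports Defs
begin

text \<open>Write \<open>k = d - 1\<close> for the number of exponents and let \<open>\<gamma>(t) = (t, t^\<alpha>\<^sub>1, \<dots>, t^\<alpha>\<^sub>k)\<close> be the \<open>curve\<close> in
  \<open>k + 1\<close> dimensions. On the simplex, the vector \<open>(1, \<nu>(x))\<close> is \<open>\<Sum>\<^sub>i \<gamma>(x\<^sub>i)\<close>. Everything rests on one
  property of the velocity \<open>\<gamma>'\<close>: its components \<open>1, \<alpha>\<^sub>j t^(\<alpha>\<^sub>j - 1)\<close> form a Chebyshev system on the
  positive reals. A nonzero combination \<open>q \<bullet> \<gamma>'\<close> has at most \<open>k\<close> positive zeros, and if it has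
  exactly \<open>k\<close> then all of them are simple and its sign alternates (\<open>velocity_few_zeros\<close>,
  \<open>velocity_sign_pattern\<close>).

  \<^bold>\<open>Extremal points are on the boundary and have small fibres.\<close> Compare \<open>x\<close> with another point \<open>y\<close>
  through \<open>N(t) = #{i. x\<^sub>i > t} - #{i. y\<^sub>i > t}\<close>. Integration gives
  \<open>\<integral> (q \<bullet> \<gamma>') N = q \<bullet> (\<Sum>\<^sub>i \<gamma>(x\<^sub>i) - \<Sum>\<^sub>i \<gamma>(y\<^sub>i))\<close>. The function \<open>N\<close> can fall only where a coordinate
  of \<open>x\<close> is passed, and passing a simple coordinate makes it fall by at most one, which is too little
  to lead from a positive integer to a negative one. Hence, if \<open>x\<close> has type (1) or (2) and
  multiplicity length \<open>k\<close>, then \<open>N\<close> changes sign at most \<open>k\<close> times, whatever \<open>y\<close> is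
  (\<open>type_1_or_2_separates\<close>). A combination \<open>q \<bullet> \<gamma>'\<close> with the same sign changes makes the integrand
  nonnegative, and the sign of the last component of \<open>q\<close> depends on \<open>x\<close> only. Two conclusions follow.
  First, no \<open>y\<close> has a value that differs from \<open>\<nu>(x)\<close> by a displacement of the last component in the
  direction fixed by that sign, so \<open>\<nu>(x)\<close> is a boundary point (\<open>type_1_or_2_in_frontier\<close>). Secondly,
  \<open>\<nu>(x) = \<nu>(y)\<close> forces \<open>N = 0\<close>, that is, \<open>y\<close> is a permutation of \<open>x\<close>; since unit vectors \<open>q\<close> have
  convergent subsequences, this passes to limits of such \<open>x\<close> (\<open>extremal_closure_unique_fibre\<close>).

  \<^bold>\<open>The boundary is contained in the closure of the extremal values.\<close> Let \<open>w\<close> be outside the image and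
  let \<open>\<nu>(x)\<close> be a nearest point of the image. The first-order conditions at \<open>x\<close> say that a combination
  \<open>q \<bullet> \<gamma>'\<close> vanishes at all positive coordinates of \<open>x\<close>, so there are at most \<open>k\<close> of them. If there are
  exactly \<open>k\<close>, the derivative of the combination alternates along them, while the second-order
  condition forbids a negative derivative at a repeated coordinate; this is type (1) or (2)
  (\<open>nearest_point_type\<close>). Values of points with fewer than \<open>k\<close> distinct positive coordinates form a
  compact set of codimension two. A generic segment from an exterior point to an interior point
  misses it, but crosses the boundary, so the boundary points outside this set are dense in the
  boundary (\<open>frontier_avoiding_short_points_dense\<close>). Near such a point every nearest point comes from
  a point of multiplicity length exactly \<open>k\<close>, hence is an extremal value.\<close>

section \<open>Zeros of generalised polynomials\<close>

text \<open>The new zeros lie strictly between consecutive old ones, hence are disjoint from them. The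
  disjointness is what excludes double zeros in \<open>velocity_sign_pattern\<close>; the bound by the maximum
  carries the induction.\<close>

lemma rolle_finite_zeros:
  fixes f f' :: "real \<Rightarrow> real"
  assumes "finite Z" "Z \<noteq> {}" "\<And>z. z \<in> Z \<Longrightarrow> 0 < z \<and> f z = 0"
    and "\<And>t. 0 < t \<Longrightarrow> (f has_real_derivative f' t) (at t)"
  shows "\<exists>Z'. finite Z' \<and> Suc (card Z') = card Z \<and> Z' \<inter> Z = {} \<and>
           (\<forall>z\<in>Z'. 0 < z \<and> z < Max Z \<and> f' z = 0)"
  using assms(1-3)
proof (induction Z rule: finite_linorder_max_induct)
  case empty
  then show ?case by simp
next
  case (insert b A)
  show ?case
  proof (cases "A = {}")
    case True
    then show ?thesis by (intro exI[of _ "{}"]) auto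
  next
    case False
    then obtain Z' where Z': "finite Z'" "Suc (card Z') = card A" "Z' \<inter> A = {}"
      "\<forall>z\<in>Z'. 0 < z \<and> z < Max A \<and> f' z = 0"
      using insert by auto
    define a where "a = Max A"
    have a: "a \<in> A" "0 < a" "a < b" "f a = 0" "f b = 0"
      using insert False by (auto simp: a_def)
    have "\<exists>z. a < z \<and> z < b \<and> DERIV f z :> 0"
    proof (rule Rolle)
      show "continuous_on {a..b} f"
        using assms(4) a
        by (intro continuous_at_imp_continuous_on ballI) (meson DERIV_isCont atLeastAtMost_iff order_less_le_trans)
      show "f differentiable (at z)" if "a < z" "z < b" for z
        using assms(4)[of z] a that by (auto simp: real_differentiable_def)
    qed (use a in auto)
    then obtain w where w: "a < w" "w < b" "DERIV f w :> 0" by blast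
    then have w': "f' w = 0" using assms(4)[of w] a DERIV_unique by force
    have m: "Max (insert b A) = b" using insert by (auto intro!: Max_eqI)
    have "w \<notin> A" using w insert(1) unfolding a_def using Max_ge leD by blast
    moreover have "w \<notin> Z'" using Z' w unfolding a_def by force
    moreover have "b \<notin> Z'" using Z'(4) a(3) unfolding a_def by force
    moreover have "b \<notin> A" using insert by auto
    ultimately show ?thesis
      using Z' w w' a insert(1) unfolding m a_def
      by (intro exI[of _ "insert w Z'"]) (auto intro: less_trans)
  qed
qed

text \<open>A sum of \<open>r\<close> distinct real powers has at most \<open>r - 1\<close> positive zeros, unless it vanishes: division by
  one of the powers and differentiation removes one summand, and costs at most one zero by Rolle's
  theorem. Real exponents keep this class of functions closed under both operations.\<close>

lemma powr_sum_zeros_imp_zero: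
  fixes b c :: "'i \<Rightarrow> real"
  assumes "finite I" "inj_on b I" "finite Z" "card I \<le> card Z"
    and "\<And>z. z \<in> Z \<Longrightarrow> 0 < z \<and> (\<Sum>i\<in>I. c i * z powr b i) = 0"
  shows "\<forall>i\<in>I. c i = 0"
  using assms
proof (induction I arbitrary: b c Z rule: finite_induct)
  case empty
  then show ?case by simp
next
  case (insert i0 I)
  \<comment> \<open>Division by the power with index \<open>i0\<close> makes its summand constant.\<close>
  define f where "f t = (\<Sum>i\<in>insert i0 I. c i * t powr (b i - b i0))" for t
  define f' where "f' t = (\<Sum>i\<in>I. (c i * (b i - b i0)) * t powr (b i - b i0 - 1))" for t
  have der: "(f has_real_derivative f' t) (at t)" if "0 < t" for t
  proof -
    have "((\<lambda>t. \<Sum>i\<in>insert i0 I. c i * t powr (b i - b i0)) has_real_derivative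
       (\<Sum>i\<in>insert i0 I. c i * ((b i - b i0) * t powr (b i - b i0 - 1)))) (at t)"
      using that by (intro DERIV_sum DERIV_cmult has_real_derivative_powr)
    then show ?thesis using insert(1,2) by (simp add: f_def[abs_def] f'_def mult_ac)
  qed
  have fz: "0 < z \<and> f z = 0" if "z \<in> Z" for z
  proof -
    have z: "0 < z" "(\<Sum>i\<in>insert i0 I. c i * z powr b i) = 0" using insert.prems that by auto
    have "f z = (\<Sum>i\<in>insert i0 I. c i * z powr b i) * z powr (- b i0)"
      unfolding f_def sum_distrib_right
      by (intro sum.cong refl) (simp add: powr_diff powr_minus divide_inverse)
    with z show ?thesis by simp
  qed
  have ne: "Z \<noteq> {}" using insert by auto
  obtain Z' where Z': "finite Z'" "Suc (card Z') = card Z" "\<forall>z\<in>Z'. 0 < z \<and> z < Max Z \<and> f' z = 0"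
    using rolle_finite_zeros[OF insert.prems(2) ne fz der] by blast
  have "\<forall>i\<in>I. c i * (b i - b i0) = 0"
  proof (rule insert.IH[where b="\<lambda>i. b i - b i0 - 1" and Z=Z'])
    show "inj_on (\<lambda>i. b i - b i0 - 1) I" using insert.prems(1) by (auto simp: inj_on_def)
    show "card I \<le> card Z'" using insert Z' by simp
  qed (use Z' in \<open>auto simp: f'_def\<close>)
  then have I0: "\<forall>i\<in>I. c i = 0" using insert by (auto simp: inj_on_def)
  obtain z where "z \<in> Z" using ne by blast
  with insert.prems(4) have "0 < z" "c i0 * z powr b i0 + (\<Sum>i\<in>I. c i * z powr b i) = 0"
    using insert by auto
  then show ?case using I0 by auto
qed

definition curve :: "('m::finite \<Rightarrow> nat) \<Rightarrow> real \<Rightarrow> real \<times> (real ^ 'm)" where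
  "curve \<alpha> t = (t, \<chi> j. t ^ \<alpha> j)"

definition velocity :: "('m::finite \<Rightarrow> nat) \<Rightarrow> real \<Rightarrow> real \<times> (real ^ 'm)" where
  "velocity \<alpha> t = (1, \<chi> j. real (\<alpha> j) * t ^ (\<alpha> j - 1))"

definition acceleration :: "('m::finite \<Rightarrow> nat) \<Rightarrow> real \<Rightarrow> real \<times> (real ^ 'm)" where
  "acceleration \<alpha> t = (0, \<chi> j. real (\<alpha> j) * real (\<alpha> j - 1) * t ^ (\<alpha> j - 2))"

lemma inner_velocity:
  "q \<bullet> velocity \<alpha> t = fst q + (\<Sum>j\<in>UNIV. snd q $ j * real (\<alpha> j) * t ^ (\<alpha> j - 1))"
  by (simp add: velocity_def inner_prod_def inner_vec_def mult_ac)

lemma inner_acceleration: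
  "q \<bullet> acceleration \<alpha> t =
     (\<Sum>j\<in>UNIV. snd q $ j * real (\<alpha> j) * real (\<alpha> j - 1) * t ^ (\<alpha> j - 2))"
  by (simp add: acceleration_def inner_prod_def inner_vec_def mult_ac)

lemma continuous_velocity: "continuous_on UNIV (velocity \<alpha>)"
  unfolding velocity_def by (intro continuous_intros)

lemma acceleration_few_zeros:
  fixes \<alpha> :: "'m::finite \<Rightarrow> nat"
  assumes "inj \<alpha>" "\<And>j. 1 < \<alpha> j" "snd q \<noteq> 0" "finite Z"
    and "\<And>z. z \<in> Z \<Longrightarrow> 0 < z \<and> q \<bullet> acceleration \<alpha> z = 0"
  shows "card Z < CARD('m)"
proof (rule ccontr)
  assume *: "\<not> card Z < CARD('m)"
  have "\<forall>j\<in>UNIV. snd q $ j * real (\<alpha> j) * real (\<alpha> j - 1) = 0"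
  proof (rule powr_sum_zeros_imp_zero[where b="\<lambda>j. real (\<alpha> j - 2)" and Z=Z])
    show "inj (\<lambda>j. real (\<alpha> j - 2))"
    proof (rule injI)
      fix i j assume "real (\<alpha> i - 2) = real (\<alpha> j - 2)"
      then have "\<alpha> i = \<alpha> j" using assms(2)[of i] assms(2)[of j] by simp
      then show "i = j" using assms(1) by (simp add: inj_eq)
    qed
    show "0 < z \<and> (\<Sum>j\<in>UNIV. snd q $ j * real (\<alpha> j) * real (\<alpha> j - 1) * z powr real (\<alpha> j - 2)) = 0"
      if "z \<in> Z" for z
      using assms(5)[OF that] by (simp add: inner_acceleration powr_realpow)
  qed (use * assms in auto)
  then have "snd q $ j = 0" for j using assms(2)[of j] by auto
  then show False using assms(3) by (simp add: vec_eq_iff)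
qed

text \<open>The derivative of the combination has one summand less, so this is one application of Rolle's
  theorem above the bound for \<open>acceleration\<close>.\<close>

lemma velocity_few_zeros:
  fixes \<alpha> :: "'m::finite \<Rightarrow> nat"
  assumes "inj \<alpha>" "\<And>j. 1 < \<alpha> j" "q \<noteq> 0" "finite Z"
    and "\<And>z. z \<in> Z \<Longrightarrow> 0 < z \<and> q \<bullet> velocity \<alpha> z = 0"
  shows "card Z \<le> CARD('m)"
proof (rule ccontr)
  assume *: "\<not> card Z \<le> CARD('m)"
  then obtain z0 where z0: "z0 \<in> Z" by fastforce
  have der: "((\<lambda>t. q \<bullet> velocity \<alpha> t) has_real_derivative q \<bullet> acceleration \<alpha> t) (at t)" for t
    unfolding inner_velocity inner_acceleration
    by (auto intro!: derivative_eq_intros sum.cong simp: mult_ac numeral_2_eq_2)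
  show False
  proof (cases "snd q = 0")
    case True
    then have "fst q = 0" using assms(5)[OF z0] by (simp add: inner_velocity)
    with True assms(3) show False by (simp add: prod_eq_iff)
  next
    case False
    obtain Z' where Z': "finite Z'" "Suc (card Z') = card Z"
      "\<forall>z\<in>Z'. 0 < z \<and> z < Max Z \<and> q \<bullet> acceleration \<alpha> z = 0"
      using rolle_finite_zeros[OF assms(4) _ assms(5) der] z0 by blast
    then have "card Z' < CARD('m)"
      using acceleration_few_zeros[OF assms(1,2) False] by blast
    with Z' * show False by simp
  qed
qed

text \<open>The sign of a function that is positive near infinity and changes sign exactly at the members of
  the list, counted with multiplicity.\<close>

definition step_sign :: "real list \<Rightarrow> real \<Rightarrow> real" where
  "step_sign us t = (\<Prod>u\<leftarrow>us. if t < u then -1 else 1)"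

lemma pderiv_sum_eq: "pderiv (\<Sum>i\<in>A. f i) = (\<Sum>i\<in>A. pderiv (f i))"
  by (induction A rule: infinite_finite_induct) (simp_all add: pderiv_add)

text \<open>The maximal number of zeros leaves no room for a further or a multiple one. As a polynomial the
  combination is therefore \<open>(\<Prod>z\<in>Z. t - z) r(t)\<close> with \<open>r\<close> free of positive zeros, hence of constant
  sign, and the signs are those of the product.\<close>

lemma velocity_sign_pattern:
  fixes \<alpha> :: "'m::finite \<Rightarrow> nat"
  assumes "inj \<alpha>" "\<And>j. 1 < \<alpha> j" "q \<noteq> 0" "finite Z" "card Z = CARD('m)"
    and zero: "\<And>z. z \<in> Z \<Longrightarrow> 0 < z \<and> q \<bullet> velocity \<alpha> z = 0"
  obtains \<sigma> :: real where "\<sigma> = 1 \<or> \<sigma> = -1"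
    "\<And>t. 0 < t \<Longrightarrow> 0 \<le> \<sigma> * (-1) ^ card {z\<in>Z. t < z} * (q \<bullet> velocity \<alpha> t)"
    "\<And>z. z \<in> Z \<Longrightarrow> 0 < \<sigma> * (-1) ^ card {u\<in>Z. z < u} * (q \<bullet> acceleration \<alpha> z)"
proof -
  define p where "p = [:fst q:] + (\<Sum>j\<in>UNIV. monom (snd q $ j * real (\<alpha> j)) (\<alpha> j - 1))"
  have p: "poly p t = q \<bullet> velocity \<alpha> t" for t
    by (simp add: p_def inner_velocity poly_sum poly_monom)
  have p': "poly (pderiv p) t = q \<bullet> acceleration \<alpha> t" for t
  proof -
    have "pderiv p = (\<Sum>j\<in>UNIV. monom (of_nat (\<alpha> j - 1) * (snd q $ j * real (\<alpha> j))) (\<alpha> j - 1 - 1))"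
      unfolding p_def pderiv_add pderiv_sum_eq pderiv_monom by simp
    then show ?thesis
      unfolding inner_acceleration
      by (simp add: poly_sum poly_monom) (intro sum.cong refl, simp add: numeral_2_eq_2)
  qed
  have der: "((\<lambda>t. q \<bullet> velocity \<alpha> t) has_real_derivative q \<bullet> acceleration \<alpha> t) (at t)" for t
    using poly_DERIV[of p t] by (simp add: p p')
  have fact: "\<exists>r. p = (\<Prod>z\<in>A. [:-z, 1:]) * r" if "A \<subseteq> Z" for A
    using finite_subset[OF that assms(4)] that
  proof (induction A rule: finite_induct)
    case (insert a A)
    then obtain r where r: "p = (\<Prod>z\<in>A. [:-z, 1:]) * r" by auto
    have "poly p a = 0" using zero insert by (simp add: p)
    moreover have "poly (\<Prod>z\<in>A. [:-z, 1:]) a \<noteq> 0"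
      using insert by (auto simp: poly_prod)
    ultimately have "poly r a = 0" by (simp add: r)
    then obtain r' where r': "r = [:-a, 1:] * r'" using poly_eq_0_iff_dvd by blast
    have "p = (\<Prod>z\<in>insert a A. [:-z, 1:]) * r'"
      unfolding r r' prod.insert[OF insert.hyps(1,2)] by (simp only: mult_ac)
    then show ?case by blast
  qed simp
  then obtain r where r: "p = (\<Prod>z\<in>Z. [:-z, 1:]) * r" by blast
  have c0: "snd q \<noteq> 0"
  proof
    assume "snd q = 0"
    moreover obtain z where "z \<in> Z" using assms(5) by fastforce
    ultimately have "fst q = 0" using zero[of z] by (simp add: inner_velocity)
    with \<open>snd q = 0\<close> assms(3) show False by (simp add: prod_eq_iff)
  qed
  have accz: "q \<bullet> acceleration \<alpha> z \<noteq> 0" if "z \<in> Z" for z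
  proof
    assume z: "q \<bullet> acceleration \<alpha> z = 0"
    have ne: "Z \<noteq> {}" using that by blast
    obtain Z' where Z': "finite Z'" "Suc (card Z') = card Z" "Z' \<inter> Z = {}"
      "\<forall>z\<in>Z'. 0 < z \<and> z < Max Z \<and> q \<bullet> acceleration \<alpha> z = 0"
      using rolle_finite_zeros[OF assms(4) ne zero der] by blast
    have "card (insert z Z') < CARD('m)"
    proof (rule acceleration_few_zeros[OF assms(1,2) c0])
      show "0 < u \<and> q \<bullet> acceleration \<alpha> u = 0" if "u \<in> insert z Z'" for u
        using that Z'(4) z zero[OF \<open>z \<in> Z\<close>] by blast
    qed (use Z' in simp)
    moreover have "z \<notin> Z'" using Z' that by auto
    ultimately show False using Z' assms(5) by simp
  qed
  have acc: "q \<bullet> acceleration \<alpha> z = (\<Prod>u\<in>Z - {z}. z - u) * poly r z" if "z \<in> Z" for z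
  proof -
    have "p = [:-z, 1:] * ((\<Prod>u\<in>Z - {z}. [:-u, 1:]) * r)"
      unfolding r using that assms(4) by (simp add: prod.remove[of Z z] mult_ac)
    then have "poly (pderiv p) z = poly ((\<Prod>u\<in>Z - {z}. [:-u, 1:]) * r) z"
      by (simp only: pderiv_mult) (simp add: pderiv_pCons)
    then show ?thesis by (simp add: p' poly_prod)
  qed
  have r0: "poly r t \<noteq> 0" if "0 < t" for t
  proof
    assume *: "poly r t = 0"
    show False
    proof (cases "t \<in> Z")
      case True
      then show False using acc[OF True] accz[OF True] * by simp
    next
      case False
      have "q \<bullet> velocity \<alpha> t = 0"
        unfolding p[symmetric] r using * by simp
      then have "card (insert t Z) \<le> CARD('m)"
        using velocity_few_zeros[OF assms(1,2,3), of "insert t Z"] that zero assms(4) by auto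
      then show False using False assms by simp
    qed
  qed
  define \<sigma> where "\<sigma> = sgn (poly r 1)"
  have s: "\<sigma> = 1 \<or> \<sigma> = -1" using r0[of 1] by (auto simp: \<sigma>_def sgn_if)
  have rs: "0 < \<sigma> * poly r t" if "0 < t" for t
  proof (rule ccontr)
    assume "\<not> ?thesis"
    then have "poly r 1 * poly r t < 0"
      using r0[OF that] r0[of 1] by (auto simp: \<sigma>_def sgn_if mult_less_0_iff zero_less_mult_iff split: if_splits)
    moreover from this have "t \<noteq> 1" by (auto simp: mult_less_0_iff)
    ultimately have "\<exists>x>0. poly r x = 0"
    proof (cases "t < 1")
      case True
      then obtain x where "t < x" "poly r x = 0"
        using poly_IVT[of t 1 r] \<open>poly r 1 * poly r t < 0\<close> by (auto simp: mult.commute)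
      then show ?thesis using that by (intro exI[of _ x]) auto
    next
      case False
      then obtain x where "1 < x" "poly r x = 0"
        using poly_IVT[of 1 t r] \<open>poly r 1 * poly r t < 0\<close> \<open>t \<noteq> 1\<close> by auto
      then show ?thesis by (intro exI[of _ x]) auto
    qed
    then show False using r0 by blast
  qed
  have sgnprod: "\<exists>c\<ge>0. (\<Prod>u\<in>A. t - u) = (-1) ^ card {u\<in>A. t < u} * c \<and> (t \<notin> A \<longrightarrow> c > 0)"
    if "finite A" for A and t :: real
    using that
  proof (induction A rule: finite_induct)
    case empty
    show ?case by (intro exI[of _ 1]) simp
  next
    case (insert a A)
    then obtain c where c: "c \<ge> 0" "(\<Prod>u\<in>A. t - u) = (-1) ^ card {u\<in>A. t < u} * c"
      "t \<notin> A \<longrightarrow> c > 0" by blast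
    have "{u\<in>insert a A. t < u} = (if t < a then insert a {u\<in>A. t < u} else {u\<in>A. t < u})" by auto
    with insert have cd: "card {u\<in>insert a A. t < u} = (if t < a then Suc (card {u\<in>A. t < u}) else card {u\<in>A. t < u})"
      by auto
    show ?case
      using c insert unfolding cd by (intro exI[of _ "\<bar>t - a\<bar> * c"]) (auto simp: algebra_simps)
  qed
  show ?thesis
  proof
    show "\<sigma> = 1 \<or> \<sigma> = -1" by (fact s)
    show "0 \<le> \<sigma> * (-1) ^ card {z\<in>Z. t < z} * (q \<bullet> velocity \<alpha> t)" if "0 < t" for t
    proof -
      obtain c where c: "c \<ge> 0" "(\<Prod>u\<in>Z. t - u) = (-1) ^ card {u\<in>Z. t < u} * c"
        using sgnprod[OF assms(4)] by blast
      have "q \<bullet> velocity \<alpha> t = (\<Prod>u\<in>Z. t - u) * poly r t"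
        unfolding p[symmetric] r by (simp add: poly_prod)
      then have "\<sigma> * (-1) ^ card {z\<in>Z. t < z} * (q \<bullet> velocity \<alpha> t) =
        ((-1) ^ card {u\<in>Z. t < u} * (-1) ^ card {u\<in>Z. t < u}) * (c * (\<sigma> * poly r t))"
        unfolding c by (simp add: mult_ac)
      also have "\<dots> = c * (\<sigma> * poly r t)"
        by simp
      finally show ?thesis
        using mult_nonneg_nonneg[OF c(1) less_imp_le[OF rs[OF that]]] by (simp only:)
    qed
    show "0 < \<sigma> * (-1) ^ card {u\<in>Z. z < u} * (q \<bullet> acceleration \<alpha> z)" if "z \<in> Z" for z
    proof -
      obtain c where c: "c > 0" "(\<Prod>u\<in>Z - {z}. z - u) = (-1) ^ card {u\<in>Z - {z}. z < u} * c"
        using sgnprod[of "Z - {z}"] assms(4) by blast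
      have e: "{u\<in>Z - {z}. z < u} = {u\<in>Z. z < u}" by auto
      have "\<sigma> * (-1) ^ card {u\<in>Z. z < u} * (q \<bullet> acceleration \<alpha> z) =
        ((-1) ^ card {u\<in>Z. z < u} * (-1) ^ card {u\<in>Z. z < u}) * (c * (\<sigma> * poly r z))"
        unfolding acc[OF that] c e by (simp add: mult_ac)
      also have "\<dots> = c * (\<sigma> * poly r z)"
        by simp
      finally show ?thesis
        using mult_pos_pos[OF c(1) rs[OF conjunct1[OF zero[OF that]]]] by (simp only:)
    qed
  qed
qed

section \<open>Combinations of velocities with prescribed sign changes\<close>

lemma step_sign_Nil [simp]: "step_sign [] t = 1"
  and step_sign_Cons [simp]: "step_sign (u # us) t = (if t < u then -1 else 1) * step_sign us t"
  by (simp_all add: step_sign_def)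

lemma step_sign_cases: "step_sign us t = 1 \<or> step_sign us t = -1"
  by (induction us) auto

lemma step_sign_eq_1: "(\<And>u. u \<in> set us \<Longrightarrow> u \<le> t) \<Longrightarrow> step_sign us t = 1"
  by (induction us) (auto simp: not_less[symmetric])

lemma step_sign_eq_power: "(\<And>u. u \<in> set us \<Longrightarrow> t < u) \<Longrightarrow> step_sign us t = (-1) ^ length us"
  by (induction us) auto

lemma step_sign_distinct: "distinct us \<Longrightarrow> step_sign us t = (-1) ^ card {u\<in>set us. t < u}"
proof (induction us)
  case (Cons a us)
  have "{u\<in>set (a # us). t < u} = (if t < a then insert a {u\<in>set us. t < u} else {u\<in>set us. t < u})"
    by auto
  with Cons show ?case by (auto simp: card_insert_if)
qed simp

lemma step_sign_right_constant: "\<exists>\<delta>>0. \<forall>s. t \<le> s \<and> s < t + \<delta> \<longrightarrow> step_sign us s = step_sign us t \<and> (s = t \<or> s \<notin> set us)"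
proof (induction us)
  case (Cons a us)
  then obtain \<delta> where \<delta>: "\<delta> > 0" "\<forall>s. t \<le> s \<and> s < t + \<delta> \<longrightarrow> step_sign us s = step_sign us t \<and> (s = t \<or> s \<notin> set us)"
    by blast
  define \<eta> where "\<eta> = (if t < a then min \<delta> (a - t) else \<delta>)"
  have "0 < \<eta>" "\<eta> \<le> \<delta>" "t < a \<Longrightarrow> t + \<eta> \<le> a" using \<delta>(1) by (auto simp: \<eta>_def)
  then have "step_sign (a # us) s = step_sign (a # us) t \<and> (s = t \<or> s \<notin> set (a # us))"
    if "t \<le> s" "s < t + \<eta>" for s
    using \<delta>(2)[rule_format, of s] that by auto
  with \<open>0 < \<eta>\<close> show ?case by blast
qed (auto intro: exI[of _ 1])

text \<open>The \<open>k\<close> velocities at the prescribed points do not span a space of dimension \<open>k + 1\<close>, so some \<open>q\<close> is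
  orthogonal to all of them.\<close>

lemma velocity_with_sign_changes_distinct:
  fixes \<alpha> :: "'m::finite \<Rightarrow> nat"
  assumes \<alpha>: "inj \<alpha>" "\<And>j. 1 < \<alpha> j"
    and us: "length us = CARD('m)" "distinct us" "\<And>u. u \<in> set us \<Longrightarrow> 0 < u"
  shows "\<exists>q. norm q = 1 \<and> (\<forall>t>0. 0 \<le> step_sign us t * (q \<bullet> velocity \<alpha> t))"
proof -
  have card: "card (set us) = CARD('m)" using us distinct_card by fastforce
  have "dim (velocity \<alpha> ` set us) \<le> card (velocity \<alpha> ` set us)"
    by (simp add: dim_le_card')
  also have "\<dots> \<le> CARD('m)" using card card_image_le[of "set us" "velocity \<alpha>"] by simp
  finally have "dim (velocity \<alpha> ` set us) < DIM(real \<times> (real ^ 'm))" by simp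
  then obtain q where q: "q \<noteq> 0" "span (velocity \<alpha> ` set us) \<subseteq> {x. q \<bullet> x = 0}"
    using lowdim_subset_hyperplane by blast
  then have zero: "0 < z \<and> q \<bullet> velocity \<alpha> z = 0" if "z \<in> set us" for z
    using that us(3) by (auto intro: span_base)
  obtain \<sigma> :: real where \<sigma>: "\<sigma> = 1 \<or> \<sigma> = -1"
    "\<And>t. 0 < t \<Longrightarrow> 0 \<le> \<sigma> * (-1) ^ card {z\<in>set us. t < z} * (q \<bullet> velocity \<alpha> t)"
    by (rule velocity_sign_pattern[OF \<alpha> q(1) List.finite_set card zero], assumption) (rule that)
  define q' where "q' = (\<sigma> / norm q) *\<^sub>R q"
  have "norm q' = 1" using q \<sigma>(1) by (auto simp: q'_def)
  moreover have "0 \<le> step_sign us t * (q' \<bullet> velocity \<alpha> t)" if "0 < t" for t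
  proof -
    have "step_sign us t * (q' \<bullet> velocity \<alpha> t) =
      (\<sigma> * (-1) ^ card {z\<in>set us. t < z} * (q \<bullet> velocity \<alpha> t)) / norm q"
      by (simp add: q'_def step_sign_distinct[OF us(2)])
    then show ?thesis using \<sigma>(2)[OF that] by simp
  qed
  ultimately show ?thesis by blast
qed

lemma unit_vector_limit:
  fixes q :: "nat \<Rightarrow> 'a::euclidean_space"
  assumes "\<And>n. norm (q n) = 1"
  obtains l r where "norm l = 1" "strict_mono r" "(q \<circ> r) \<longlonglongrightarrow> l"
proof -
  have "seq_compact (sphere (0::'a) 1)"
    using compact_sphere compact_eq_seq_compact_metric by blast
  then show ?thesis using that assms
    unfolding seq_compact_def by (metis mem_sphere_0)
qed

lemma step_sign_cong:
  assumes "length us = length vs" "\<And>i. i < length us \<Longrightarrow> t < us ! i \<longleftrightarrow> t < vs ! i"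
  shows "step_sign us t = step_sign vs t"
  using assms
proof (induction us vs rule: list_induct2)
  case (Cons u us v vs)
  have "t < u \<longleftrightarrow> t < v" using Cons.prems[of 0] by simp
  moreover have "step_sign us t = step_sign vs t"
    using Cons.prems by (intro Cons.IH) (metis Suc_less_eq length_Cons nth_Cons_Suc)
  ultimately show ?case by simp
qed simp

text \<open>Coinciding points and the point \<open>0\<close> are reached as limits: the \<open>i\<close>-th point is shifted to the right
  by \<open>\<epsilon> (i + 1)\<close>, which separates the points for all but finitely many \<open>\<epsilon>\<close>, and a limit of the
  resulting unit vectors as \<open>\<epsilon>\<close> tends to \<open>0\<close> has the required signs.\<close>

lemma velocity_with_sign_changes:
  fixes \<alpha> :: "'m::finite \<Rightarrow> nat"
  assumes \<alpha>: "inj \<alpha>" "\<And>j. 1 < \<alpha> j"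
    and us: "length us = CARD('m)" "\<And>u. u \<in> set us \<Longrightarrow> 0 \<le> u"
  shows "\<exists>q. norm q = 1 \<and> (\<forall>t\<ge>0. 0 \<le> step_sign us t * (q \<bullet> velocity \<alpha> t))"
proof -
  define shift where "shift \<epsilon> = map (\<lambda>i. us ! i + \<epsilon> * (real i + 1)) [0..<length us]" for \<epsilon>
  have len: "length (shift \<epsilon>) = length us" for \<epsilon> by (simp add: shift_def)
  have "\<exists>\<epsilon>. 0 < \<epsilon> \<and> \<epsilon> < inverse (real (Suc n)) \<and> distinct (shift \<epsilon>)" for n
  proof -
    \<comment> \<open>Contains the values of \<open>\<epsilon>\<close> for which two shifted points coincide.\<close>
    define B where "B = (\<lambda>(i,k). (us ! k - us ! i) / (real i - real k)) ` ({..<length us} \<times> {..<length us})"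
    have "finite B" by (simp add: B_def)
    moreover have "infinite {0<..<inverse (real (Suc n))}" by (intro infinite_Ioo) simp
    ultimately obtain \<epsilon> where \<epsilon>: "\<epsilon> \<in> {0<..<inverse (real (Suc n))}" "\<epsilon> \<notin> B"
      by (meson finite_subset subsetI)
    have "distinct (shift \<epsilon>)"
      unfolding shift_def distinct_map
    proof (intro conjI inj_onI; clarsimp?)
      fix i k assume ik: "i < length us" "k < length us"
        and eq: "us ! i + \<epsilon> * (real i + 1) = us ! k + \<epsilon> * (real k + 1)"
      show "i = k"
      proof (rule ccontr)
        assume "i \<noteq> k"
        then have "\<epsilon> = (us ! k - us ! i) / (real i - real k)"
          using eq by (simp add: field_simps)
        then have "\<epsilon> \<in> B" using ik by (auto simp: B_def)
        with \<epsilon> show False by simp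
      qed
    qed
    with \<epsilon> show ?thesis by auto
  qed
  then obtain \<epsilon> where \<epsilon>: "\<And>n. 0 < \<epsilon> n" "\<And>n. \<epsilon> n < inverse (real (Suc n))" "\<And>n. distinct (shift (\<epsilon> n))"
    by metis
  have "\<epsilon> \<longlonglongrightarrow> 0"
  proof (rule tendsto_sandwich[OF _ _ tendsto_const LIMSEQ_inverse_real_of_nat])
    show "\<forall>\<^sub>F n in sequentially. 0 \<le> \<epsilon> n" using \<epsilon>(1) by (simp add: less_imp_le)
    show "\<forall>\<^sub>F n in sequentially. \<epsilon> n \<le> inverse (real (Suc n))"
      using \<epsilon>(2) by (simp add: less_imp_le)
  qed
  have "\<exists>q. norm q = 1 \<and> (\<forall>t>0. 0 \<le> step_sign (shift (\<epsilon> n)) t * (q \<bullet> velocity \<alpha> t))" for n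
  proof (rule velocity_with_sign_changes_distinct[OF \<alpha>])
    show "0 < u" if "u \<in> set (shift (\<epsilon> n))" for u
      using that us(2) \<epsilon>(1)[of n] by (auto simp: shift_def intro!: add_nonneg_pos mult_pos_pos)
  qed (use us \<epsilon> len in auto)
  then obtain q where q: "\<And>n. norm (q n) = 1"
    "\<And>n t. 0 < t \<Longrightarrow> 0 \<le> step_sign (shift (\<epsilon> n)) t * (q n \<bullet> velocity \<alpha> t)"
    by metis
  obtain l r where l: "norm l = 1" "strict_mono r" "(q \<circ> r) \<longlonglongrightarrow> l"
    by (rule unit_vector_limit[of q, OF q(1)]) (rule that)
  have regular: "0 \<le> step_sign us t * (l \<bullet> velocity \<alpha> t)" if "0 < t" "t \<notin> set us" for t
  proof (rule tendsto_lowerbound)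
    show "(\<lambda>n. step_sign us t * ((q \<circ> r) n \<bullet> velocity \<alpha> t)) \<longlonglongrightarrow> step_sign us t * (l \<bullet> velocity \<alpha> t)"
      by (intro tendsto_intros l)
    have "\<forall>\<^sub>F n in sequentially. t < us ! i \<longleftrightarrow> t < shift (\<epsilon> n) ! i" if i: "i < length us" for i
    proof -
      have "(\<lambda>n. us ! i + \<epsilon> n * (real i + 1)) \<longlonglongrightarrow> us ! i + 0 * (real i + 1)"
        by (intro tendsto_intros \<open>\<epsilon> \<longlonglongrightarrow> 0\<close>)
      then have lim: "(\<lambda>n. shift (\<epsilon> n) ! i) \<longlonglongrightarrow> us ! i"
        using i by (simp add: shift_def)
      have "us ! i \<noteq> t" using i \<open>t \<notin> set us\<close> by force
      then consider "t < us ! i" | "us ! i < t" by linarith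
      then show ?thesis
        using order_tendstoD[OF lim, of t]
        by cases (auto elim: eventually_mono)
    qed
    then have "\<forall>\<^sub>F n in sequentially. \<forall>i\<in>{..<length us}. t < us ! i \<longleftrightarrow> t < shift (\<epsilon> n) ! i"
      by (intro eventually_ball_finite) auto
    then have "\<forall>\<^sub>F n in sequentially. step_sign us t = step_sign (shift (\<epsilon> n)) t"
      by (rule eventually_mono) (intro step_sign_cong, auto simp: len)
    then have "\<forall>\<^sub>F n in sequentially. step_sign us t = step_sign (shift (\<epsilon> (r n))) t"
      using eventually_subseq[OF l(2)] by blast
    then show "\<forall>\<^sub>F n in sequentially. 0 \<le> step_sign us t * ((q \<circ> r) n \<bullet> velocity \<alpha> t)"
      by (rule eventually_mono) (use q(2) \<open>0 < t\<close> in simp)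
  qed simp
  have "0 \<le> step_sign us t * (l \<bullet> velocity \<alpha> t)" if t: "0 \<le> t" for t
  proof -
    obtain \<delta> where \<delta>: "\<delta> > 0"
      "\<And>s. t \<le> s \<Longrightarrow> s < t + \<delta> \<Longrightarrow> step_sign us s = step_sign us t \<and> (s = t \<or> s \<notin> set us)"
      using step_sign_right_constant by blast
    have "\<forall>\<^sub>F s in at_right t. 0 \<le> step_sign us t * (l \<bullet> velocity \<alpha> s)"
      unfolding eventually_at_right_field
    proof (intro exI[of _ "t + \<delta>"] conjI allI impI)
      fix s assume s: "t < s" "s < t + \<delta>"
      then show "0 \<le> step_sign us t * (l \<bullet> velocity \<alpha> s)"
        using regular[of s] \<delta>(2)[of s] t by auto
    qed (use \<delta> in simp)
    moreover have "((\<lambda>s. step_sign us t * (l \<bullet> velocity \<alpha> s)) \<longlongrightarrow> step_sign us t * (l \<bullet> velocity \<alpha> t)) (at_right t)"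
      using continuous_velocity[of \<alpha>]
      by (intro tendsto_intros) (metis UNIV_I at_within_open continuous_on_def filterlim_at_split open_UNIV)
    ultimately show ?thesis by (intro tendsto_lowerbound) auto
  qed
  with l(1) show ?thesis by blast
qed

text \<open>The component with the largest exponent dominates at infinity.\<close>

lemma top_coefficient_nonneg:
  fixes \<alpha> :: "'m::{finite,linorder} \<Rightarrow> nat"
  assumes \<alpha>: "strict_mono \<alpha>" "\<And>j. 1 < \<alpha> j"
    and nonneg: "\<And>t. T \<le> t \<Longrightarrow> 0 \<le> q \<bullet> velocity \<alpha> t"
  shows "0 \<le> snd q $ Max UNIV"
proof -
  define e where "e = \<alpha> (Max UNIV)"
  have e: "1 < e" using \<alpha> by (simp add: e_def)
  have pow: "((\<lambda>t::real. t ^ a / t ^ b) \<longlongrightarrow> 0) at_top" if "a < b" for a b :: nat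
  proof -
    have "((\<lambda>t::real. inverse (t ^ (b - a))) \<longlongrightarrow> 0) at_top"
      using that by (intro tendsto_inverse_0_at_top filterlim_pow_at_top filterlim_ident) simp
    moreover have "\<forall>\<^sub>F t::real in at_top. inverse (t ^ (b - a)) = t ^ a / t ^ b"
      using eventually_gt_at_top[of 0]
      by eventually_elim (use that in \<open>simp add: power_diff divide_simps\<close>)
    ultimately show ?thesis by (rule Lim_transform_eventually)
  qed
  have "((\<lambda>t. fst q * (t ^ 0 / t ^ (e - 1)) +
      (\<Sum>j\<in>UNIV. snd q $ j * real (\<alpha> j) * (t ^ (\<alpha> j - 1) / t ^ (e - 1))))
      \<longlongrightarrow> fst q * 0 + (\<Sum>j\<in>UNIV. snd q $ j * real (\<alpha> j) * (if j = Max UNIV then 1 else 0))) at_top"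
  proof (intro tendsto_intros pow)
    fix j
    show "((\<lambda>t::real. t ^ (\<alpha> j - 1) / t ^ (e - 1)) \<longlongrightarrow> (if j = Max UNIV then 1 else 0)) at_top"
    proof (cases "j = Max UNIV")
      case True
      have "\<forall>\<^sub>F t::real in at_top. 1 = t ^ (\<alpha> j - 1) / t ^ (e - 1)"
        using eventually_gt_at_top[of 0] by eventually_elim (simp add: True e_def)
      then have "((\<lambda>t::real. t ^ (\<alpha> j - 1) / t ^ (e - 1)) \<longlongrightarrow> 1) at_top"
        by (rule Lim_transform_eventually[OF tendsto_const])
      then show ?thesis using True by simp
    next
      case False
      then have "j < Max UNIV" by (simp add: order_less_le)
      then have "\<alpha> j - 1 < e - 1" using \<alpha>(1) \<alpha>(2)[of j] unfolding e_def by (simp add: strict_mono_less diff_less_mono)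
      then show ?thesis using False pow by simp
    qed
  qed (use e in simp)
  then have "((\<lambda>t. fst q * (t ^ 0 / t ^ (e - 1)) +
      (\<Sum>j\<in>UNIV. snd q $ j * real (\<alpha> j) * (t ^ (\<alpha> j - 1) / t ^ (e - 1))))
      \<longlongrightarrow> snd q $ Max UNIV * real e) at_top"
    by (simp add: e_def if_distrib cong: if_cong)
  moreover have "\<forall>\<^sub>F t in at_top. 0 \<le> fst q * (t ^ 0 / t ^ (e - 1)) +
      (\<Sum>j\<in>UNIV. snd q $ j * real (\<alpha> j) * (t ^ (\<alpha> j - 1) / t ^ (e - 1)))"
    using eventually_ge_at_top[of T] eventually_gt_at_top[of 0]
  proof eventually_elim
    case (elim t)
    have "fst q * (t ^ 0 / t ^ (e - 1)) +
      (\<Sum>j\<in>UNIV. snd q $ j * real (\<alpha> j) * (t ^ (\<alpha> j - 1) / t ^ (e - 1))) = (q \<bullet> velocity \<alpha> t) / t ^ (e - 1)"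
      by (simp add: inner_velocity add_divide_distrib sum_divide_distrib)
    with elim nonneg show ?case by simp
  qed
  ultimately have "0 \<le> snd q $ Max UNIV * real e" by (intro tendsto_lowerbound) auto
  with e show ?thesis by (simp add: zero_le_mult_iff)
qed

section \<open>Sign changes of the difference of two counting functions\<close>

definition tail_count :: "real ^ 'n::finite \<Rightarrow> real \<Rightarrow> nat" where
  "tail_count x t = card {i. t < x $ i}"

definition tail_diff :: "real ^ 'n::finite \<Rightarrow> real ^ 'n \<Rightarrow> real \<Rightarrow> real" where
  "tail_diff x y t = real (tail_count x t) - real (tail_count y t)"

lemma tail_count_antimono: "s \<le> t \<Longrightarrow> tail_count x t \<le> tail_count x s"
  unfolding tail_count_def by (intro card_mono) auto

lemma tail_count_eq_0: "(\<And>i. x $ i \<le> t) \<Longrightarrow> tail_count x t = 0"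
  by (auto simp: tail_count_def not_less[symmetric])

lemma tail_count_right_constant: "\<forall>\<^sub>F s in at_right t. tail_count x s = tail_count x t"
proof -
  have "\<forall>\<^sub>F s in at_right t. s < x $ i \<longleftrightarrow> t < x $ i" for i
  proof (cases "t < x $ i")
    case True
    then show ?thesis
      unfolding eventually_at_right_field by (intro exI[of _ "x $ i"]) auto
  next
    case False
    then show ?thesis
      unfolding eventually_at_right_field by (intro exI[of _ "t + 1"]) auto
  qed
  then have "\<forall>\<^sub>F s in at_right t. \<forall>i. s < x $ i \<longleftrightarrow> t < x $ i"
    by (simp add: eventually_all_finite)
  then show ?thesis by (rule eventually_mono) (simp add: tail_count_def)
qed

lemma tail_diff_right_constant:
  obtains \<delta> where "\<delta> > 0" "\<And>s. t \<le> s \<Longrightarrow> s < t + \<delta> \<Longrightarrow> tail_diff x y s = tail_diff x y t"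
proof -
  have "\<forall>\<^sub>F s in at_right t. tail_diff x y s = tail_diff x y t"
    using tail_count_right_constant[of x t] tail_count_right_constant[of y t]
    by eventually_elim (simp add: tail_diff_def)
  then obtain b where b: "b > t" "\<forall>s. t < s \<longrightarrow> s < b \<longrightarrow> tail_diff x y s = tail_diff x y t"
    unfolding eventually_at_right_field by blast
  show ?thesis
  proof (rule that[of "b - t"])
    show "tail_diff x y s = tail_diff x y t" if "t \<le> s" "s < t + (b - t)" for s
      using b(2) that by (cases "s = t") auto
  qed (use b in simp)
qed

text \<open>If the difference cannot return from positive to negative values on an interval, one switch from
  nonpositive to nonnegative describes its sign there. The infimum of the positive set belongs to it,
  because counting functions are constant to the right of every point.\<close>

lemma tail_diff_switch_point:
  assumes "b \<le> a"
    and stays: "\<And>t t'. b \<le> t \<Longrightarrow> t < t' \<Longrightarrow> t' < a \<Longrightarrow> 0 < tail_diff x y t \<Longrightarrow> 0 \<le> tail_diff x y t'"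
  obtains s where "b \<le> s" "s \<le> a"
    "\<And>t. b \<le> t \<Longrightarrow> t < s \<Longrightarrow> tail_diff x y t \<le> 0"
    "\<And>t. s \<le> t \<Longrightarrow> t < a \<Longrightarrow> 0 \<le> tail_diff x y t"
proof (cases "\<exists>t. b \<le> t \<and> t < a \<and> 0 < tail_diff x y t")
  case False
  then show ?thesis using assms(1) by (intro that[of a]) (auto simp: not_less)
next
  case True
  define A where "A = {t. b \<le> t \<and> t < a \<and> 0 < tail_diff x y t}"
  \<comment> \<open>The infimum lies in \<open>A\<close> by right continuity, so the inequality also holds at the switch itself.\<close>
  define s where "s = Inf A"
  have A: "A \<noteq> {}" "bdd_below A" using True by (auto simp: A_def intro!: bdd_belowI[of _ b])
  have bs: "b \<le> s" unfolding s_def using A by (intro cInf_greatest) (auto simp: A_def)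
  have sle: "s \<le> t" if "t \<in> A" for t unfolding s_def using A that by (intro cInf_lower)
  have sa: "s < a"
  proof -
    obtain t where "t \<in> A" using A by blast
    with sle[OF this] show ?thesis by (simp add: A_def)
  qed
  have sA: "0 < tail_diff x y s"
  proof -
    obtain \<delta> where \<delta>: "\<delta> > 0" "\<And>u. s \<le> u \<Longrightarrow> u < s + \<delta> \<Longrightarrow> tail_diff x y u = tail_diff x y s"
      by (rule tail_diff_right_constant[of s x y]) (rule that)
    obtain t where "t \<in> A" "t < s + \<delta>"
      using A \<delta>(1) cInf_lessD[of A "s + \<delta>"] by (auto simp: s_def)
    then show ?thesis using \<delta>(2)[of t] sle[of t] by (simp add: A_def)
  qed
  show ?thesis
  proof (rule that[of s])
    show "tail_diff x y t \<le> 0" if "b \<le> t" "t < s" for t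
      using sle[of t] that sa by (force simp: A_def)
    show "0 \<le> tail_diff x y t" if "s \<le> t" "t < a" for t
      using stays[of s t] bs that sA by (cases "s = t") auto
  qed (use bs sa in auto)
qed

text \<open>Passing a single coordinate of \<open>x\<close> lowers the difference by at most one, and the difference takes
  integer values; the coordinates of \<open>y\<close> only raise it.\<close>

lemma tail_diff_stays_nonneg:
  fixes x y :: "real ^ 'n::finite"
  assumes "t \<le> t'" "card {i. x $ i = v} = 1" "\<And>i. t < x $ i \<Longrightarrow> x $ i \<le> t' \<Longrightarrow> x $ i = v"
    and "0 < tail_diff x y t"
  shows "0 \<le> tail_diff x y t'"
proof -
  have "{i. t < x $ i} \<subseteq> {i. t' < x $ i} \<union> {i. x $ i = v}"
    using assms(3) by (auto simp: not_less[symmetric])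
  then have "tail_count x t \<le> card ({i. t' < x $ i} \<union> {i. x $ i = v})"
    unfolding tail_count_def by (intro card_mono) auto
  also have "\<dots> \<le> tail_count x t' + 1"
    using card_Un_le[of "{i. t' < x $ i}" "{i. x $ i = v}"] assms(2) by (simp add: tail_count_def)
  finally have "tail_count x t \<le> tail_count x t' + 1" .
  moreover have "tail_count y t' \<le> tail_count y t" by (rule tail_count_antimono[OF assms(1)])
  ultimately show ?thesis using assms(4) by (simp add: tail_diff_def)
qed

text \<open>The list is indexed in the same way as the multiplicity vector, with \<open>0\<close> in front whether or not it
  occurs as a coordinate.\<close>

definition levels :: "real ^ 'n::finite \<Rightarrow> real list" where
  "levels x = 0 # sorted_list_of_set (pos_values x)"

lemma finite_pos_values [simp]: "finite (pos_values (x :: real ^ 'n::finite))"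
proof -
  have "pos_values x \<subseteq> range (\<lambda>i. x $ i)" by (auto simp: pos_values_def)
  then show ?thesis by (rule finite_subset) simp
qed

lemma length_levels: "length (levels x) = Suc (mult_length x)"
  by (simp add: levels_def mult_length_def)

lemma set_levels: "set (levels x) = insert 0 (pos_values x)"
  by (simp add: levels_def)

lemma sorted_levels: "sorted_wrt (<) (levels x)"
  proof -
  have "0 < v" if "v \<in> set (sorted_list_of_set (pos_values x))" for v
    using that finite_pos_values[of x] by (simp add: set_sorted_list_of_set) (simp add: pos_values_def)
  then show ?thesis by (simp add: levels_def)
qed

lemma mult_vector_nth: "e \<le> mult_length x \<Longrightarrow> mult_vector x ! e = card {i. x $ i = levels x ! e}"
  by (simp add: mult_vector_def levels_def[symmetric] length_levels)

lemma levels_0 [simp]: "levels x ! 0 = 0"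
  by (simp add: levels_def)

lemma levels_less: "e < e' \<Longrightarrow> e' \<le> mult_length x \<Longrightarrow> levels x ! e < levels x ! e'"
  using sorted_wrt_nth_less[OF sorted_levels[of x]] by (simp add: length_levels)

lemma levels_less_iff:
  assumes "e \<le> mult_length x" "e' \<le> mult_length x"
  shows "levels x ! e < levels x ! e' \<longleftrightarrow> e < e'"
  using levels_less[of e e' x] levels_less[of e' e x] assms by (metis less_asym' linorder_neqE_nat order_less_irrefl)

lemma coordinate_is_level:
  assumes "\<And>i. 0 \<le> x $ i"
  obtains e where "e \<le> mult_length x" "x $ i = levels x ! e"
proof -
  have "x $ i \<in> set (levels x)"
    using assms[of i] by (auto simp: set_levels pos_values_def)
  then show ?thesis using that unfolding in_set_conv_nth length_levels by (auto simp: less_Suc_eq_le)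
qed

text \<open>On \<open>[a, \<infinity>)\<close> the difference of the counting functions is weakly positive and negative in turn, with
  changes in \<open>us\<close> and final sign \<open>\<tau>\<close>.\<close>

definition separates :: "real ^ 'n::finite \<Rightarrow> real ^ 'n \<Rightarrow> real \<Rightarrow> real list \<Rightarrow> real \<Rightarrow> bool" where
  "separates x y a us \<tau> \<longleftrightarrow> (\<forall>u\<in>set us. a \<le> u) \<and>
     (\<forall>t\<ge>a. 0 \<le> \<tau> * step_sign us t * tail_diff x y t)"

text \<open>Downward induction on \<open>e\<close> in steps of two. Between the levels \<open>e\<close> and \<open>e + 2\<close> the only coordinate of
  \<open>x\<close> is simple, so the difference switches there at most once, from nonpositive to nonnegative. This
  switch and the level \<open>e + 2\<close> are the two new points of change. Just below each of the levels used,
  the prescribed sign is positive; above the last level the difference is nonpositive.\<close>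

lemma separates_above_simple_levels:
  fixes x y :: "real ^ 'n::finite"
  assumes x: "\<And>i. 0 \<le> x $ i" and e: "e \<le> mult_length x"
    and simple: "\<And>i. e < i \<Longrightarrow> i \<le> mult_length x \<Longrightarrow> odd (i - e) \<Longrightarrow> card {k. x $ k = levels x ! i} = 1"
  shows "\<exists>us. length us = mult_length x - e \<and>
    separates x y (levels x ! e) us (if even (mult_length x - e) then -1 else 1)"
  using e simple
proof (induction "mult_length x - e" arbitrary: e rule: less_induct)
  case less
  define l where "l = mult_length x"
  have stays: "0 \<le> tail_diff x y t'"
    if st: "e < l" "levels x ! e \<le> t" "t < t'" "e + 2 \<le> l \<longrightarrow> t' < levels x ! (e + 2)" "0 < tail_diff x y t" for t t'
  proof (rule tail_diff_stays_nonneg[OF _ _ _ st(5)])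
    show "card {k. x $ k = levels x ! (e + 1)} = 1"
      using less.prems(2)[of "e + 1"] st by (simp add: l_def)
    show "x $ i = levels x ! (e + 1)" if i: "t < x $ i" "x $ i \<le> t'" for i
    proof -
      obtain f where f: "f \<le> l" "x $ i = levels x ! f"
        using coordinate_is_level[of x i] x unfolding l_def by blast
      have "e < f" using f i st(2) less.prems(1) levels_less_iff[of e x f] by (simp add: l_def)
      moreover have "f < e + 2"
      proof (cases "e + 2 \<le> l")
        case True
        then show ?thesis using f i st(4) levels_less_iff[of f x "e + 2"] by (simp add: l_def)
      qed (use f in simp)
      ultimately have "f = e + 1" by simp
      then show ?thesis using f by simp
    qed
  qed (use st in simp)
  consider "e = l" | "e + 1 = l" | "e + 2 \<le> l" using less.prems(1) by (force simp: l_def)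
  then show ?case
  proof cases
    case 1
    have "tail_count x t = 0" if "levels x ! e \<le> t" for t
    proof (rule tail_count_eq_0)
      fix i
      obtain f where f: "f \<le> l" "x $ i = levels x ! f"
        using coordinate_is_level[of x i] x unfolding l_def by blast
      show "x $ i \<le> t" using f levels_less_iff[of e x f] 1 that by (simp add: l_def)
    qed
    then show ?thesis
      using 1 by (intro exI[of _ "[]"]) (simp add: separates_def l_def tail_diff_def)
  next
    case 2
    define B where "B = Max (insert (levels x ! e) (range (\<lambda>i. x $ i) \<union> range (\<lambda>i. y $ i)))"
    have B: "levels x ! e \<le> B" "x $ i \<le> B" "y $ i \<le> B" for i
      unfolding B_def by (rule Max_ge; simp)+
    have above: "tail_diff x y t = 0" if "B \<le> t" for t
      using B that by (simp add: tail_diff_def tail_count_eq_0 order.trans[of _ B])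
    obtain s where s: "levels x ! e \<le> s" "s \<le> B"
      "\<And>t. levels x ! e \<le> t \<Longrightarrow> t < s \<Longrightarrow> tail_diff x y t \<le> 0"
      "\<And>t. s \<le> t \<Longrightarrow> t < B \<Longrightarrow> 0 \<le> tail_diff x y t"
      by (rule tail_diff_switch_point[OF B(1), of x y]) (use stays 2 in auto)
    have "separates x y (levels x ! e) [s] 1"
      unfolding separates_def
    proof (intro conjI allI impI)
      fix t assume "levels x ! e \<le> t"
      then show "0 \<le> 1 * step_sign [s] t * tail_diff x y t"
        using s(3)[of t] s(4)[of t] above[of t] by (cases "B \<le> t") auto
    qed (use s in simp)
    then show ?thesis using 2 by (intro exI[of _ "[s]"]) (auto simp: l_def[symmetric])
  next
    case 3
    define a where "a = levels x ! (e + 2)"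
    define \<tau> where "\<tau> = (if even (l - e) then -1 else (1::real))"
    have ev: "even (l - (e + 2)) = even (l - e)" using 3 by auto
    have "\<exists>us. length us = mult_length x - (e + 2) \<and> separates x y (levels x ! (e + 2)) us
      (if even (mult_length x - (e + 2)) then -1 else 1)"
    proof (rule less.hyps)
      show "card {k. x $ k = levels x ! i} = 1"
        if "e + 2 < i" "i \<le> mult_length x" "odd (i - (e + 2))" for i
        using less.prems(2)[of i] that by auto
    qed (use 3 in \<open>auto simp: l_def\<close>)
    then have "\<exists>us. length us = l - (e + 2) \<and> separates x y a us \<tau>"
      using ev by (simp add: a_def \<tau>_def l_def)
    then obtain us where us: "length us = l - (e + 2)" "\<And>u. u \<in> set us \<Longrightarrow> a \<le> u"
      "\<And>t. a \<le> t \<Longrightarrow> 0 \<le> \<tau> * step_sign us t * tail_diff x y t"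
      by (auto simp: separates_def)
    have ea: "levels x ! e < a" unfolding a_def using 3 by (intro levels_less) (auto simp: l_def)
    obtain s where s: "levels x ! e \<le> s" "s \<le> a"
      "\<And>t. levels x ! e \<le> t \<Longrightarrow> t < s \<Longrightarrow> tail_diff x y t \<le> 0"
      "\<And>t. s \<le> t \<Longrightarrow> t < a \<Longrightarrow> 0 \<le> tail_diff x y t"
      by (rule tail_diff_switch_point[OF less_imp_le[OF ea], of x y]) (use stays 3 in \<open>auto simp: a_def\<close>)
    have "separates x y (levels x ! e) (s # a # us) \<tau>"
      unfolding separates_def
    proof (intro conjI allI impI)
      show "\<forall>u\<in>set (s # a # us). levels x ! e \<le> u" using s ea us(2) by force
      fix t assume t: "levels x ! e \<le> t"
      show "0 \<le> \<tau> * step_sign (s # a # us) t * tail_diff x y t"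
      proof (cases "a \<le> t")
        case True
        then show ?thesis using us(3)[of t] s(2) by simp
      next
        case False
        then have "step_sign us t = (-1) ^ (l - (e + 2))"
          using us by (subst step_sign_eq_power) force+
        also have "\<dots> = - \<tau>"
          unfolding \<tau>_def ev[symmetric] by (simp add: minus_one_power_iff)
        finally show ?thesis using s(3)[of t] s(4)[of t] t False by (auto simp: \<tau>_def)
      qed
    qed
    then show ?thesis using us(1) 3
      unfolding \<tau>_def l_def by (intro exI[of _ "s # a # us"]) auto
  qed
qed

text \<open>Type (1) says that the levels \<open>1, 3, \<dots>\<close> are simple, so the previous lemma applies from level \<open>0\<close> on.
  Type (2) says that the levels \<open>2, 4, \<dots>\<close> are simple, so it applies from level \<open>1\<close> on; as no
  coordinate vanishes, the difference is nonnegative below this level, which becomes the remaining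
  point of change. The sign \<open>\<tau>\<close> does not depend on \<open>y\<close>.\<close>

lemma type_1_or_2_separates:
  fixes x :: "real ^ 'n::finite"
  assumes x: "\<And>i. 0 \<le> x $ i" and type: "type_1 x \<or> type_2 x" and pos: "0 < mult_length x"
  obtains \<tau> where "\<tau> = 1 \<or> \<tau> = -1"
    "\<And>y :: real ^ 'n. \<exists>us. length us = mult_length x \<and> separates x y 0 us \<tau>"
  using type
proof
  assume t1: "type_1 x"
  define \<tau> where "\<tau> = (if even (mult_length x) then -1 else (1::real))"
  have "\<exists>us. length us = mult_length x \<and> separates x y 0 us \<tau>" for y
  proof -
    have "\<exists>us. length us = mult_length x - 0 \<and>
      separates x y (levels x ! 0) us (if even (mult_length x - 0) then -1 else 1)"
    proof (rule separates_above_simple_levels[OF x])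
      fix i assume i: "0 < i" "i \<le> mult_length x" "odd (i - 0)"
      then obtain k where "i = 2 * k - 1" "k \<ge> 1" by (auto elim!: oddE intro: that[of "Suc _"])
      then show "card {k. x $ k = levels x ! i} = 1"
        using t1 i mult_vector_nth[of i x] by (simp add: type_1_def)
    qed simp
    then show ?thesis by (simp add: \<tau>_def)
  qed
  then show thesis by (intro that[of \<tau>]) (auto simp: \<tau>_def)
next
  assume t2: "type_2 x"
  define \<tau> where "\<tau> = (if even (mult_length x - 1) then -1 else (1::real))"
  define a where "a = levels x ! 1"
  have a: "0 < a" using levels_less[of 0 1 x] pos by (simp add: a_def)
  have "\<exists>us. length us = mult_length x \<and> separates x y 0 us \<tau>" for y
  proof -
    have "\<exists>us. length us = mult_length x - 1 \<and> separates x y a us \<tau>"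
      unfolding a_def \<tau>_def
    proof (rule separates_above_simple_levels[OF x])
      fix i assume i: "1 < i" "i \<le> mult_length x" "odd (i - 1)"
      then have "even i" by simp
      then obtain k where "i = 2 * k" "k \<ge> 1" using i by (auto elim!: evenE)
      then show "card {k. x $ k = levels x ! i} = 1"
        using t2 i mult_vector_nth[of i x] by (simp add: type_2_def)
    qed (use pos in simp)
    then obtain us where us: "length us = mult_length x - 1" "\<And>u. u \<in> set us \<Longrightarrow> a \<le> u"
      "\<And>t. a \<le> t \<Longrightarrow> 0 \<le> \<tau> * step_sign us t * tail_diff x y t"
      by (auto simp: separates_def)
    have "{i. x $ i = 0} = {}"
      using t2 mult_vector_nth[of 0 x] by (simp add: type_2_def)
    then have xpos: "0 < x $ i" for i using x[of i] by (metis (mono_tags) empty_iff mem_Collect_eq order_less_le)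
    have "a \<le> x $ i" for i
    proof -
      obtain f where f: "f \<le> mult_length x" "x $ i = levels x ! f"
        using coordinate_is_level[of x i] x by blast
      with xpos[of i] have "f \<noteq> 0" by (metis levels_0 order_less_irrefl)
      then show ?thesis using f levels_less_iff[of f x 1] pos by (simp add: a_def not_less[symmetric])
    qed
    then have "tail_count x t = CARD('n)" if "t < a" for t
      using that unfolding tail_count_def by (metis (mono_tags, lifting) UNIV_eq_I mem_Collect_eq order_less_le_trans)
    moreover have "tail_count y t \<le> CARD('n)" for t
      unfolding tail_count_def by (intro card_mono) auto
    ultimately have below: "0 \<le> tail_diff x y t" if "t < a" for t
      using that by (simp add: tail_diff_def)
    have "separates x y 0 (a # us) \<tau>"
      unfolding separates_def
    proof (intro conjI allI impI)
      show "\<forall>u\<in>set (a # us). 0 \<le> u" using a us(2) by force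
      fix t :: real assume t: "0 \<le> t"
      show "0 \<le> \<tau> * step_sign (a # us) t * tail_diff x y t"
      proof (cases "a \<le> t")
        case True
        then show ?thesis using us(3)[of t] by simp
      next
        case False
        then have "step_sign us t = (-1) ^ (mult_length x - 1)"
          using us by (subst step_sign_eq_power) force+
        also have "\<dots> = - \<tau>" by (simp add: \<tau>_def)
        finally show ?thesis using below[of t] False by (auto simp: \<tau>_def)
      qed
    qed
    then show ?thesis using us(1) pos by (intro exI[of _ "a # us"]) simp
  qed
  then show thesis by (intro that[of \<tau>]) (auto simp: \<tau>_def)
qed

section \<open>Equality of moments forces equality up to permutation\<close>

text \<open>Adding the first power sum as a further component makes the map a sum of values of \<open>curve\<close>, also
  away from the simplex.\<close>

definition moments :: "('m::finite \<Rightarrow> nat) \<Rightarrow> real ^ 'n::finite \<Rightarrow> real \<times> (real ^ 'm)" where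
  "moments \<alpha> x = (\<Sum>i\<in>UNIV. x $ i, vandermonde_map \<alpha> x)"

lemma moments_eq_sum_curve: "moments \<alpha> x = (\<Sum>i\<in>UNIV. curve \<alpha> (x $ i))"
  by (simp add: moments_def curve_def prod_eq_iff fst_sum snd_sum vec_eq_iff vandermonde_map_def power_sum_def)

lemma curve_has_vector_derivative: "(curve \<alpha> has_vector_derivative velocity \<alpha> t) (at t within A)"
proof -
  have "((\<lambda>t. t ^ \<alpha> j) has_vector_derivative real (\<alpha> j) * t ^ (\<alpha> j - 1)) (at t within A)" for j
    unfolding has_real_derivative_iff_has_vector_derivative[symmetric]
    by (auto intro!: derivative_eq_intros)
  then have "((\<lambda>t. \<chi> j. t ^ \<alpha> j) has_vector_derivative (\<chi> j. real (\<alpha> j) * t ^ (\<alpha> j - 1))) (at t within A)"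
    unfolding has_vector_derivative_def
    by (subst has_derivative_componentwise_within) (auto simp: Basis_vec_def inner_axis)
  then show ?thesis
    unfolding curve_def[abs_def] velocity_def by (intro has_vector_derivative_Pair has_vector_derivative_id)
qed

lemma velocity_tail_has_integral:
  assumes \<alpha>: "\<And>j. 1 < \<alpha> j" and a: "0 \<le> a" "a \<le> B"
  shows "((\<lambda>t. (q \<bullet> velocity \<alpha> t) * (if t < a then 1 else 0)) has_integral q \<bullet> curve \<alpha> a) {0..B}"
proof -
  have "curve \<alpha> 0 = 0" using order.strict_trans[OF zero_less_one \<alpha>]
    by (simp add: curve_def prod_eq_iff vec_eq_iff)
  moreover have "((\<lambda>t. q \<bullet> velocity \<alpha> t) has_integral (q \<bullet> curve \<alpha> a - q \<bullet> curve \<alpha> 0)) {0..a}"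
    using a by (intro fundamental_theorem_of_calculus)
      (auto intro!: bounded_linear.has_vector_derivative[OF bounded_linear_inner_right] curve_has_vector_derivative)
  ultimately have "((\<lambda>t. if t \<in> {0..a} then q \<bullet> velocity \<alpha> t else 0) has_integral q \<bullet> curve \<alpha> a) {0..B}"
    using a by (subst has_integral_restrict) auto
  then show ?thesis
    by (rule has_integral_spike_finite[of "{a}", rotated 2]) auto
qed

lemma tail_count_eq_sum: "real (tail_count x t) = (\<Sum>i\<in>UNIV. if t < x $ i then 1 else 0)"
  by (simp add: tail_count_def sum.If_cases)

lemma velocity_tail_diff_has_integral:
  assumes \<alpha>: "\<And>j. 1 < \<alpha> j" and "\<And>i. 0 \<le> x $ i" "\<And>i. 0 \<le> y $ i" "\<And>i. x $ i \<le> B" "\<And>i. y $ i \<le> B"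
  shows "((\<lambda>t. (q \<bullet> velocity \<alpha> t) * tail_diff x y t) has_integral q \<bullet> (moments \<alpha> x - moments \<alpha> y)) {0..B}"
proof -
  have *: "((\<lambda>t. \<Sum>i\<in>UNIV. (q \<bullet> velocity \<alpha> t) * (if t < z $ i then 1 else 0)) has_integral
      (\<Sum>i\<in>UNIV. q \<bullet> curve \<alpha> (z $ i))) {0..B}"
    if "\<And>i. 0 \<le> z $ i" "\<And>i. z $ i \<le> B" for z
    using that by (intro has_integral_sum velocity_tail_has_integral[OF \<alpha>]) auto
  show ?thesis
    using has_integral_diff[OF *[of x] *[of y]] assms
    by (simp add: tail_diff_def tail_count_eq_sum moments_eq_sum_curve inner_diff_right inner_sum_right
        right_diff_distrib sum_distrib_left)
qed

text \<open>The multiplicity of a value is the jump of the counting function at this value.\<close>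

lemma permuted_if_tail_counts_eq:
  fixes x y :: "real ^ 'n::finite"
  assumes x: "\<And>i. 0 \<le> x $ i" and y: "\<And>i. 0 \<le> y $ i"
    and eq: "\<And>t. 0 \<le> t \<Longrightarrow> tail_count x t = tail_count y t"
  shows "permuted x y"
proof -
  have card_eq: "card {i. x $ i = v} = card {i. y $ i = v}" for v
  proof (cases v "0 :: real" rule: linorder_cases)
    case less
    have "x $ i \<noteq> v" "y $ i \<noteq> v" for i using less x[of i] y[of i] by auto
    then show ?thesis by simp
  next
    case equal
    have *: "card {i. z $ i = v} + tail_count z 0 = CARD('n)" if "\<And>i. 0 \<le> z $ i" for z :: "real ^ 'n"
    proof -
      have "UNIV = {i. z $ i = v} \<union> {i. 0 < z $ i}"
        using that equal by (auto simp: order_less_le)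
      then have "CARD('n) = card ({i. z $ i = v} \<union> {i. 0 < z $ i})" by simp
      also have "\<dots> = card {i. z $ i = v} + tail_count z 0"
        unfolding tail_count_def by (rule card_Un_disjoint) (use equal in auto)
      finally show ?thesis by simp
    qed
    show ?thesis using *[OF x] *[OF y] eq[of 0] by simp
  next
    case greater
    define F where "F = {u \<in> range (\<lambda>i. x $ i) \<union> range (\<lambda>i. y $ i). u < v}"
    define t where "t = Max (insert 0 F)"
    have "finite F" by (simp add: F_def)
    then have t: "0 \<le> t" "t < v" "\<And>u. u \<in> F \<Longrightarrow> u \<le> t"
      using greater unfolding t_def by (auto simp: F_def)
    have *: "card {i. z $ i = v} + tail_count z v = tail_count z t"
      if "range (\<lambda>i. z $ i) \<subseteq> range (\<lambda>i. x $ i) \<union> range (\<lambda>i. y $ i)" for z :: "real ^ 'n"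
    proof -
      have "v \<le> z $ i" if i: "t < z $ i" for i
      proof (rule ccontr)
        assume "\<not> v \<le> z $ i"
        then have "z $ i \<in> F" using that \<open>range _ \<subseteq> _\<close> by (auto simp: F_def)
        then show False using t(3) i by force
      qed
      then have "{i. t < z $ i} = {i. z $ i = v} \<union> {i. v < z $ i}"
        using t(2) by (auto simp: order_less_le)
      then have "tail_count z t = card ({i. z $ i = v} \<union> {i. v < z $ i})" by (simp add: tail_count_def)
      also have "\<dots> = card {i. z $ i = v} + tail_count z v"
        unfolding tail_count_def by (rule card_Un_disjoint) auto
      finally show ?thesis by simp
    qed
    have "card {i. x $ i = v} + tail_count x v = tail_count x t" by (rule *) auto
    moreover have "card {i. y $ i = v} + tail_count y v = tail_count y t" by (rule *) auto
    ultimately show ?thesis using eq[of t] eq[of v] t greater by simp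
  qed
  have "image_mset (\<lambda>i. y $ i) (mset_set UNIV) = image_mset (\<lambda>i. x $ i) (mset_set UNIV)"
    by (rule multiset_eqI) (simp add: count_image_mset vimage_def card_eq)
  then obtain p where p: "p permutes UNIV" "\<forall>i\<in>UNIV. y $ i = x $ p i"
    by (rule image_mset_eq_implies_permutes[OF finite])
  then show ?thesis
    unfolding permuted_def by (intro exI[of _ p]) (auto simp: vec_eq_iff)
qed

lemma permuted_vandermonde_map_eq: "permuted x y \<Longrightarrow> vandermonde_map \<alpha> y = vandermonde_map \<alpha> x"
proof -
  assume "permuted x y"
  then obtain p where p: "p permutes UNIV" "y = (\<chi> i. x $ p i)" by (auto simp: permuted_def)
  have "(\<Sum>i\<in>UNIV. (x $ i) ^ a) = (\<Sum>i\<in>UNIV. (y $ i) ^ a)" for a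
    using sum.permute[OF p(1), of "\<lambda>i. (x $ i) ^ a"] by (simp add: p(2))
  then show ?thesis by (simp add: vandermonde_map_def power_sum_def)
qed

lemma interval_avoiding_finite_set:
  fixes a b :: real
  assumes "a < b" "finite F"
  obtains c d where "a < c" "c < d" "d < b" "{c..d} \<inter> F = {}"
proof -
  have "infinite ({a<..<b} - F)" using assms by (simp add: infinite_Ioo)
  then obtain u where u: "u \<in> {a<..<b} - F" by (metis finite.emptyI ex_in_conv)
  have "open ({a<..<b} - F)" using assms by (intro open_Diff finite_imp_closed) auto
  then obtain e where e: "e > 0" "cball u e \<subseteq> {a<..<b} - F"
    using u open_contains_cball by blast
  then have sub: "{u - e..u + e} \<subseteq> {a<..<b} - F" by (simp add: cball_eq_atLeastAtMost)
  have "u - e \<in> {a<..<b} - F" by (rule subsetD[OF sub]) (use e(1) in simp)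
  moreover have "u + e \<in> {a<..<b} - F" by (rule subsetD[OF sub]) (use e(1) in simp)
  ultimately show ?thesis using e(1) sub by (intro that[of "u - e" "u + e"]) auto
qed

text \<open>The integral of the product of \<open>q \<bullet> velocity \<alpha>\<close> and the difference of the counting functions is
  \<open>q \<bullet> (moments \<alpha> x - moments \<alpha> y)\<close>, hence not positive, although the product is nonnegative. So the
  product vanishes wherever it is continuous. The difference is locally constant to the right, and
  \<open>q \<bullet> velocity \<alpha>\<close> cannot vanish on an interval; hence the difference is zero everywhere. The finite
  set \<open>E\<close> gives room for limits, in which the signs are known only off the coordinates of \<open>x\<close>.\<close>

lemma permuted_if_signs_agree:
  fixes x y :: "real ^ 'n::finite" and \<alpha> :: "'m::finite \<Rightarrow> nat"
  assumes \<alpha>: "inj \<alpha>" "\<And>j. 1 < \<alpha> j"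
    and x: "\<And>i. 0 \<le> x $ i" and y: "\<And>i. 0 \<le> y $ i"
    and q: "q \<noteq> 0" "q \<bullet> (moments \<alpha> x - moments \<alpha> y) \<le> 0"
    and sign: "finite E" "\<And>t. 0 \<le> t \<Longrightarrow> t \<notin> E \<Longrightarrow> 0 \<le> (q \<bullet> velocity \<alpha> t) * tail_diff x y t"
  shows "permuted x y"
proof (rule permuted_if_tail_counts_eq[OF x y])
  fix t0 :: real assume t0: "0 \<le> t0"
  show "tail_count x t0 = tail_count y t0"
  proof (rule ccontr)
    assume "tail_count x t0 \<noteq> tail_count y t0"
    then have N: "tail_diff x y t0 \<noteq> 0" by (simp add: tail_diff_def)
    obtain \<delta> where \<delta>: "\<delta> > 0" "\<And>s. t0 \<le> s \<Longrightarrow> s < t0 + \<delta> \<Longrightarrow> tail_diff x y s = tail_diff x y t0"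
      by (rule tail_diff_right_constant[of t0 x y]) (rule that)
    obtain c d where cd: "t0 < c" "c < d" "d < t0 + \<delta>" "{c..d} \<inter> E = {}"
      by (rule interval_avoiding_finite_set[of t0 "t0 + \<delta>" E]) (use \<delta> sign(1) in auto)
    define B where "B = Max (insert d (range (\<lambda>i. x $ i) \<union> range (\<lambda>i. y $ i)))"
    have B: "d \<le> B" "x $ i \<le> B" "y $ i \<le> B" for i
      unfolding B_def by (rule Max_ge; simp)+
    define f where "f t = (q \<bullet> velocity \<alpha> t) * tail_diff x y t" for t
    define g where "g t = (if t \<in> E then 0 else f t)" for t
    have "(f has_integral q \<bullet> (moments \<alpha> x - moments \<alpha> y)) {0..B}"
      unfolding f_def[abs_def] by (rule velocity_tail_diff_has_integral[OF \<alpha>(2) x y B(2,3)])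
    then have g: "(g has_integral q \<bullet> (moments \<alpha> x - moments \<alpha> y)) {0..B}"
      by (rule has_integral_spike_finite[OF sign(1), rotated]) (auto simp: g_def)
    have g0: "0 \<le> g t" if "0 \<le> t" for t using sign(2) that by (simp add: g_def f_def)
    have sub: "{c..d} \<subseteq> {0..B}" using cd t0 B(1) by auto
    have cont: "continuous_on {c..d} (\<lambda>t. (q \<bullet> velocity \<alpha> t) * tail_diff x y t0)"
      by (intro continuous_intros continuous_on_subset[OF continuous_velocity]) auto
    have geq: "g t = (q \<bullet> velocity \<alpha> t) * tail_diff x y t0" if "t \<in> {c..d}" for t
      using that cd \<delta>(2)[of t] by (auto simp: g_def f_def)
    have cg: "continuous_on {c..d} g"
      by (rule continuous_on_eq[OF cont]) (use geq in simp)
    have "integral {c..d} g \<le> integral {0..B} g"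
      by (rule integral_subset_le[OF sub integrable_continuous_real[OF cg] has_integral_integrable[OF g]])
        (use g0 in auto)
    also have "\<dots> \<le> 0" using integral_unique[OF g] q(2) by simp
    finally have "integral {c..d} g \<le> 0" .
    moreover have "0 \<le> integral {c..d} g"
      by (rule integral_nonneg[OF integrable_continuous_real[OF cg]]) (use g0 cd t0 in auto)
    ultimately have "integral {c..d} g = 0" by simp
    then have "\<forall>t\<in>{c..d}. g t = 0"
      by (subst (asm) integral_eq_0_iff[OF cg cd(2)]) (use g0 cd t0 in auto)
    then have zero: "q \<bullet> velocity \<alpha> t = 0" if "t \<in> {c..d}" for t using geq[OF that] N that by simp
    obtain Z where Z: "finite Z" "card Z = Suc CARD('m)" "Z \<subseteq> {c..d}"
      using infinite_arbitrarily_large[OF infinite_Icc[OF cd(2)]] by blast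
    have "card Z \<le> CARD('m)"
    proof (rule velocity_few_zeros[OF \<alpha> q(1) Z(1)])
      show "0 < z \<and> q \<bullet> velocity \<alpha> z = 0" if "z \<in> Z" for z
        using zero[of z] Z(3) that cd t0 by auto
    qed
    then show False using Z by simp
  qed
qed

section \<open>The extremal points lie on the boundary and determine their fibres\<close>

text \<open>Every \<open>y\<close> has its own \<open>q\<close>, but the sign of the last component of \<open>q\<close> is the same for all of them:
  it is, weakly, the sign of \<open>q \<bullet> velocity \<alpha>\<close> near infinity.\<close>

lemma velocity_certificate:
  fixes x :: "real ^ 'n::finite" and \<alpha> :: "'m::{finite,linorder} \<Rightarrow> nat"
  assumes \<alpha>: "strict_mono \<alpha>" "\<And>j. 1 < \<alpha> j"
    and x: "\<And>i. 0 \<le> x $ i" "mult_length x = CARD('m)" "type_1 x \<or> type_2 x"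
  obtains \<tau> :: real where "\<tau> = 1 \<or> \<tau> = -1"
    "\<And>y. \<exists>q. norm q = 1 \<and> 0 \<le> \<tau> * snd q $ Max UNIV \<and>
       (\<forall>t\<ge>0. 0 \<le> (q \<bullet> velocity \<alpha> t) * tail_diff x y t)"
proof -
  have inj: "inj \<alpha>" using \<alpha>(1) by (rule strict_mono_imp_inj_on)
  obtain \<tau> where \<tau>: "\<tau> = 1 \<or> \<tau> = -1"
    "\<And>y. \<exists>us. length us = mult_length x \<and> separates x y 0 us \<tau>"
  proof (rule type_1_or_2_separates[OF x(1,3)])
    show "0 < mult_length x" using x(2) by simp
  qed (rule that)
  show ?thesis
  proof (rule that[OF \<tau>(1)])
    fix y :: "real ^ 'n"
    obtain us where us: "length us = CARD('m)" "\<And>u. u \<in> set us \<Longrightarrow> 0 \<le> u"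
      "\<And>t. 0 \<le> t \<Longrightarrow> 0 \<le> \<tau> * step_sign us t * tail_diff x y t"
      using \<tau>(2)[of y] x(2) by (auto simp: separates_def)
    obtain q where q: "norm q = 1" "\<And>t. 0 \<le> t \<Longrightarrow> 0 \<le> step_sign us t * (q \<bullet> velocity \<alpha> t)"
      using velocity_with_sign_changes[OF inj \<alpha>(2) us(1,2)] by blast
    define T where "T = Max (insert 0 (set us))"
    have T: "0 \<le> T" "\<And>u. u \<in> set us \<Longrightarrow> u \<le> T" by (auto simp: T_def)
    have "0 \<le> snd q $ Max UNIV"
    proof (rule top_coefficient_nonneg[OF \<alpha>])
      show "0 \<le> q \<bullet> velocity \<alpha> t" if "T \<le> t" for t
        using q(2)[of t] step_sign_eq_1[of us t] T that by force
    qed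
    moreover have "0 \<le> (\<tau> *\<^sub>R q \<bullet> velocity \<alpha> t) * tail_diff x y t" if "0 \<le> t" for t
    proof -
      have "0 \<le> (\<tau> * step_sign us t * tail_diff x y t) * (step_sign us t * (q \<bullet> velocity \<alpha> t))"
        by (intro mult_nonneg_nonneg us q that)
      then show ?thesis using step_sign_cases[of us t] by (auto simp: mult_ac)
    qed
    moreover have "norm (\<tau> *\<^sub>R q) = 1" using q(1) \<tau>(1) by auto
    moreover have "\<tau> * snd (\<tau> *\<^sub>R q) $ Max UNIV = snd q $ Max UNIV" using \<tau>(1) by auto
    ultimately show "\<exists>q. norm q = 1 \<and> 0 \<le> \<tau> * snd q $ Max UNIV \<and>
       (\<forall>t\<ge>0. 0 \<le> (q \<bullet> velocity \<alpha> t) * tail_diff x y t)"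
      by metis
  qed
qed

lemma std_simplex_nonneg: "x \<in> std_simplex \<Longrightarrow> 0 \<le> x $ i"
  by (simp add: std_simplex_def)

lemma compact_std_simplex: "compact (std_simplex :: (real ^ 'n::finite) set)"
proof -
  have "closed (std_simplex :: (real ^ 'n) set)"
    unfolding std_simplex_def
    by (intro closed_Collect_conj closed_Collect_all closed_Collect_le closed_Collect_eq continuous_intros)
  moreover have "(std_simplex :: (real ^ 'n) set) \<subseteq> cbox 0 1"
  proof
    fix x :: "real ^ 'n" assume "x \<in> std_simplex"
    then have x: "\<And>i. 0 \<le> x $ i" "(\<Sum>i\<in>UNIV. x $ i) = 1" by (auto simp: std_simplex_def)
    have "x $ i \<le> 1" for i using member_le_sum[of i UNIV "\<lambda>i. x $ i"] x by simp
    with x show "x \<in> cbox 0 1" by (simp add: mem_box_cart)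
  qed
  ultimately show ?thesis using bounded_cbox bounded_subset compact_eq_bounded_closed by blast
qed

lemma continuous_on_vandermonde_map: "continuous_on A (vandermonde_map \<alpha>)"
  unfolding vandermonde_map_def power_sum_def by (intro continuous_intros)

lemma closed_image: "closed (vandermonde_map \<alpha> ` std_simplex)"
  by (intro compact_imp_closed compact_continuous_image continuous_on_vandermonde_map compact_std_simplex)

lemma inner_moments_diff_simplex:
  assumes "x \<in> std_simplex" "y \<in> std_simplex"
  shows "q \<bullet> (moments \<alpha> x - moments \<alpha> y) = snd q \<bullet> (vandermonde_map \<alpha> x - vandermonde_map \<alpha> y)"
  using assms by (simp add: moments_def std_simplex_def inner_prod_def)

text \<open>Otherwise some \<open>y\<close> has a value displaced from that of \<open>x\<close> along the last axis, in the direction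
  for which the certificate of \<open>x\<close> and \<open>y\<close> shows that the two points are permutations of each
  other.\<close>

lemma type_1_or_2_in_frontier:
  fixes x :: "real ^ 'n::finite" and \<alpha> :: "'m::{finite,linorder} \<Rightarrow> nat"
  assumes \<alpha>: "strict_mono \<alpha>" "\<And>j. 1 < \<alpha> j"
    and x: "x \<in> std_simplex" "mult_length x = CARD('m)" "type_1 x \<or> type_2 x"
  shows "vandermonde_map \<alpha> x \<in> frontier (vandermonde_map \<alpha> ` (std_simplex :: (real ^ 'n) set))"
proof -
  let ?P = "vandermonde_map \<alpha> ` (std_simplex :: (real ^ 'n) set)"
  obtain \<tau> :: real where \<tau>: "\<tau> = 1 \<or> \<tau> = -1"
    "\<And>y. \<exists>q. norm q = 1 \<and> 0 \<le> \<tau> * snd q $ Max UNIV \<and>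
       (\<forall>t\<ge>0. 0 \<le> (q \<bullet> velocity \<alpha> t) * tail_diff x y t)"
    by (rule velocity_certificate[OF \<alpha> std_simplex_nonneg[OF x(1)] x(2,3)]) (rule that)
  have "vandermonde_map \<alpha> x \<notin> interior ?P"
  proof
    assume "vandermonde_map \<alpha> x \<in> interior ?P"
    then obtain e where e: "e > 0" "cball (vandermonde_map \<alpha> x) e \<subseteq> ?P"
      using mem_interior_cball by blast
    define v where "v = (\<tau> * e) *\<^sub>R axis (Max (UNIV :: 'm set)) (1 :: real)"
    have nv: "norm v = e" using \<tau>(1) e(1) by (auto simp: v_def norm_axis_1)
    then have "vandermonde_map \<alpha> x + v \<in> ?P" using e by (auto simp: dist_norm)
    then obtain y :: "real ^ 'n" where y: "y \<in> std_simplex" "vandermonde_map \<alpha> y = vandermonde_map \<alpha> x + v"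
      by auto
    obtain q where q: "norm q = 1" "0 \<le> \<tau> * snd q $ Max UNIV"
      "\<And>t. 0 \<le> t \<Longrightarrow> 0 \<le> (q \<bullet> velocity \<alpha> t) * tail_diff x y t"
      using \<tau>(2)[of y] by blast
    have "q \<bullet> (moments \<alpha> x - moments \<alpha> y) = - (e * (\<tau> * snd q $ Max UNIV))"
      by (simp add: inner_moments_diff_simplex x y v_def inner_axis)
    also have "\<dots> \<le> 0" using q(2) e(1) by simp
    finally have "permuted x y"
      using permuted_if_signs_agree[OF strict_mono_imp_inj_on[OF \<alpha>(1)] \<alpha>(2) std_simplex_nonneg[OF x(1)]
          std_simplex_nonneg[OF y(1)], of q "{}"] q by force
    then have "v = 0" using permuted_vandermonde_map_eq[of x y \<alpha>] y(2) by simp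
    with nv e(1) show False by simp
  qed
  then show ?thesis
    using x(1) closure_subset[of ?P] by (auto simp: frontier_def)
qed

lemma tail_count_tendsto:
  assumes "X \<longlonglongrightarrow> x" "t \<notin> range (\<lambda>i. x $ i)"
  shows "\<forall>\<^sub>F n in sequentially. tail_count (X n) t = tail_count x t"
proof -
  have "\<forall>\<^sub>F n in sequentially. t < X n $ i \<longleftrightarrow> t < x $ i" for i
  proof -
    have lim: "(\<lambda>n. X n $ i) \<longlonglongrightarrow> x $ i" using assms(1) by (rule tendsto_vec_nth)
    consider "t < x $ i" | "x $ i < t" using assms(2) by (metis linorder_neqE_linordered_idom rangeI)
    then show ?thesis using order_tendstoD[OF lim, of t] by cases (auto elim: eventually_mono)
  qed
  then have "\<forall>\<^sub>F n in sequentially. \<forall>i. t < X n $ i \<longleftrightarrow> t < x $ i" by (simp add: eventually_all_finite)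
  then show ?thesis by (rule eventually_mono) (simp add: tail_count_def)
qed

text \<open>A limit point need not be of type (1) or (2), and its multiplicity length may be smaller. What
  survives in the limit is the certificate against any given point of the fibre.\<close>

lemma extremal_closure_unique_fibre:
  fixes \<alpha> :: "'m::{finite,linorder} \<Rightarrow> nat"
  assumes \<alpha>: "strict_mono \<alpha>" "\<And>j. 1 < \<alpha> j"
    and z: "z \<in> closure (vandermonde_map \<alpha> ` {x \<in> (std_simplex :: (real ^ 'n::finite) set).
             mult_length x = CARD('m) \<and> (type_1 x \<or> type_2 x)})"
  shows "\<exists>x \<in> (std_simplex :: (real ^ 'n) set). vandermonde_map \<alpha> x = z \<and>
              (\<forall>x' \<in> std_simplex. vandermonde_map \<alpha> x' = z \<longrightarrow> permuted x x')"
proof -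
  let ?S = "{x \<in> (std_simplex :: (real ^ 'n::finite) set).
             mult_length x = CARD('m) \<and> (type_1 x \<or> type_2 x)}"
  obtain Z where Z: "\<And>n. Z n \<in> vandermonde_map \<alpha> ` ?S" "Z \<longlonglongrightarrow> z"
    using z unfolding closure_sequential by blast
  then have "\<forall>n. \<exists>x. x \<in> ?S \<and> Z n = vandermonde_map \<alpha> x" by blast
  from choice[OF this] obtain X where "\<forall>n. X n \<in> ?S \<and> Z n = vandermonde_map \<alpha> (X n)" by (rule exE)
  then have X: "\<And>n. X n \<in> ?S" "\<And>n. Z n = vandermonde_map \<alpha> (X n)" by blast+
  have "seq_compact (std_simplex :: (real ^ 'n) set)"
    using compact_std_simplex compact_eq_seq_compact_metric by blast
  then obtain x r where x: "x \<in> std_simplex" "strict_mono (r :: nat \<Rightarrow> nat)" "(X \<circ> r) \<longlonglongrightarrow> x"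
    using X(1) unfolding seq_compact_def by blast
  have "(\<lambda>n. vandermonde_map \<alpha> ((X \<circ> r) n)) \<longlonglongrightarrow> vandermonde_map \<alpha> x"
    using continuous_on_vandermonde_map[of "UNIV :: (real ^ 'n) set" \<alpha>] x(3)
    by (intro isCont_tendsto_compose[of _ "vandermonde_map \<alpha>"]) (simp add: continuous_on_eq_continuous_at)
  moreover have "(\<lambda>n. vandermonde_map \<alpha> ((X \<circ> r) n)) \<longlonglongrightarrow> z"
    using LIMSEQ_subseq_LIMSEQ[OF Z(2) x(2)] X(2) by (simp add: o_def)
  ultimately have xz: "vandermonde_map \<alpha> x = z" by (rule LIMSEQ_unique)
  have "permuted x y" if y: "y \<in> std_simplex" "vandermonde_map \<alpha> y = z" for y
  proof -
    have "\<exists>q. norm q = 1 \<and> (\<forall>t\<ge>0. 0 \<le> (q \<bullet> velocity \<alpha> t) * tail_diff ((X \<circ> r) n) y t)" for n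
    proof -
      have "\<And>i. 0 \<le> (X \<circ> r) n $ i" "mult_length ((X \<circ> r) n) = CARD('m)"
        "type_1 ((X \<circ> r) n) \<or> type_2 ((X \<circ> r) n)"
        using X(1)[of "r n"] by (auto intro: std_simplex_nonneg)
      then obtain \<tau> :: real where "\<And>y. \<exists>q. norm q = 1 \<and> 0 \<le> \<tau> * snd q $ Max UNIV \<and>
          (\<forall>t\<ge>0. 0 \<le> (q \<bullet> velocity \<alpha> t) * tail_diff ((X \<circ> r) n) y t)"
        by (rule velocity_certificate[OF \<alpha>]) (rule that)
      then show ?thesis by blast
    qed
    then obtain q where q: "\<And>n. norm (q n) = 1"
      "\<And>n t. 0 \<le> t \<Longrightarrow> 0 \<le> (q n \<bullet> velocity \<alpha> t) * tail_diff ((X \<circ> r) n) y t"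
      by metis
    obtain l s where l: "norm l = 1" "strict_mono s" "(q \<circ> s) \<longlonglongrightarrow> l"
      by (rule unit_vector_limit[of q, OF q(1)]) (rule that)
    have "(X \<circ> r \<circ> s) \<longlonglongrightarrow> x" using x(3) l(2) by (rule LIMSEQ_subseq_LIMSEQ)
    show ?thesis
    proof (rule permuted_if_signs_agree[OF strict_mono_imp_inj_on[OF \<alpha>(1)] \<alpha>(2) std_simplex_nonneg[OF x(1)]
          std_simplex_nonneg[OF y(1)]])
      show "l \<noteq> 0" using l(1) by auto
      show "l \<bullet> (moments \<alpha> x - moments \<alpha> y) \<le> 0"
        using xz y x(1) by (simp add: inner_moments_diff_simplex)
      show "finite (range (\<lambda>i. x $ i))" by simp
      show "0 \<le> (l \<bullet> velocity \<alpha> t) * tail_diff x y t" if t: "0 \<le> t" "t \<notin> range (\<lambda>i. x $ i)" for t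
      proof (rule tendsto_lowerbound)
        show "(\<lambda>n. ((q \<circ> s) n \<bullet> velocity \<alpha> t) * tail_diff x y t) \<longlonglongrightarrow> (l \<bullet> velocity \<alpha> t) * tail_diff x y t"
          by (intro tendsto_intros l)
        show "\<forall>\<^sub>F n in sequentially. 0 \<le> ((q \<circ> s) n \<bullet> velocity \<alpha> t) * tail_diff x y t"
          using tail_count_tendsto[OF \<open>(X \<circ> r \<circ> s) \<longlonglongrightarrow> x\<close> t(2)]
        proof eventually_elim
          case (elim n)
          then show ?case using q(2)[OF t(1), of "s n"] by (simp add: tail_diff_def)
        qed
      qed simp
    qed
  qed
  with x(1) xz show ?thesis by blast
qed

section \<open>Interior points\<close>

lemma moments_has_derivative:
  "(moments \<alpha> has_derivative (\<lambda>u. \<Sum>i\<in>UNIV. u $ i *\<^sub>R velocity \<alpha> (x $ i))) (at x)"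
proof -
  have "((\<lambda>x. curve \<alpha> (x $ i)) has_derivative (\<lambda>u. u $ i *\<^sub>R velocity \<alpha> (x $ i))) (at x)" for i
  proof -
    have "((\<lambda>x. x $ i) has_derivative (\<lambda>u. u $ i)) (at x)"
      by (intro bounded_linear_imp_has_derivative bounded_linear_vec_nth)
    moreover have "(curve \<alpha> has_derivative (\<lambda>h. h *\<^sub>R velocity \<alpha> (x $ i))) (at (x $ i))"
      using curve_has_vector_derivative by (simp add: has_vector_derivative_def)
    ultimately show ?thesis by (rule has_derivative_compose)
  qed
  then show ?thesis
    unfolding moments_eq_sum_curve[abs_def] by (intro has_derivative_sum) auto
qed

lemma vandermonde_map_differentiable: "vandermonde_map \<alpha> differentiable (at x)"
proof -
  have "((\<lambda>x. snd (moments \<alpha> x)) has_derivative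
      (\<lambda>u. snd (\<Sum>i\<in>UNIV. u $ i *\<^sub>R velocity \<alpha> (x $ i)))) (at x)"
    by (rule bounded_linear.has_derivative[OF bounded_linear_snd moments_has_derivative])
  then show ?thesis by (auto simp: moments_def differentiable_def)
qed

lemma continuous_on_moments: "continuous_on A (moments \<alpha>)"
  unfolding moments_def by (intro continuous_intros continuous_on_vandermonde_map)

text \<open>The derivative of \<open>moments\<close> has the velocities at the coordinates in its range. More than \<open>k\<close> of
  them span the space, so \<open>moments\<close> is open at \<open>x\<close>, and the points near \<open>x\<close> with coordinate sum \<open>1\<close>
  already cover a neighbourhood of the value.\<close>

lemma distinct_positive_imp_interior:
  fixes x :: "real ^ 'n::finite" and \<alpha> :: "'m::finite \<Rightarrow> nat"
  assumes \<alpha>: "inj \<alpha>" "\<And>j. 1 < \<alpha> j" and card: "CARD('m) < CARD('n)"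
    and x: "x \<in> std_simplex" "\<And>i. 0 < x $ i" "inj (\<lambda>i. x $ i)"
  shows "vandermonde_map \<alpha> x \<in> interior (vandermonde_map \<alpha> ` (std_simplex :: (real ^ 'n) set))"
proof -
  define L where "L = (\<lambda>u :: real ^ 'n. \<Sum>i\<in>UNIV. u $ i *\<^sub>R velocity \<alpha> (x $ i))"
  have lin: "linear L"
    unfolding L_def by (intro linear_compose_sum ballI) (auto intro!: linearI simp: algebra_simps)
  have "surj L"
  proof (rule ccontr)
    assume "\<not> surj L"
    moreover have "span (range L) = range L"
      by (rule span_eq_iff[THEN iffD2, OF linear_subspace_image[OF lin subspace_UNIV]])
    ultimately have "\<exists>q. q \<noteq> 0 \<and> range L \<subseteq> {v. q \<bullet> v = 0}"
      using span_not_univ_subset_hyperplane[of "range L"] by metis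
    then obtain q where q: "q \<noteq> 0" "range L \<subseteq> {v. q \<bullet> v = 0}" by blast
    have zero: "q \<bullet> velocity \<alpha> (x $ i) = 0" for i
    proof -
      have "L (axis i 1) = (\<Sum>k\<in>UNIV. if k = i then velocity \<alpha> (x $ k) else 0)"
        unfolding L_def by (intro sum.cong) (auto simp: axis_def)
      then have "L (axis i 1) = velocity \<alpha> (x $ i)" by simp
      moreover have "q \<bullet> L (axis i 1) = 0" using q(2) by blast
      ultimately show ?thesis by simp
    qed
    have "card (range (\<lambda>i. x $ i)) \<le> CARD('m)"
      by (rule velocity_few_zeros[OF \<alpha> q(1)]) (use zero x(2) in auto)
    then show False using card card_image[OF x(3)] by simp
  qed
  then obtain g where g: "linear g" "L \<circ> g = id"
    using linear_surjective_right_inverse[OF lin] by blast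
  define T where "T = {u :: real ^ 'n. \<forall>i. 0 < u $ i}"
  have "T = (\<Inter>i. {u. 0 < u $ i})" by (auto simp: T_def)
  moreover have "open {u :: real ^ 'n. 0 < u $ i}" for i
    by (intro open_Collect_less continuous_intros)
  ultimately have "open T" by (simp add: open_INT)
  then have "moments \<alpha> x \<in> interior (moments \<alpha> ` T)"
    using x(2) g moments_has_derivative[of \<alpha> x, folded L_def]
    by (intro sussmann_open_mapping[of UNIV _ _ L g])
      (auto simp: continuous_on_moments interior_open T_def linear_conv_bounded_linear)
  moreover have "moments \<alpha> x = (1, vandermonde_map \<alpha> x)"
    using x(1) by (simp add: moments_def std_simplex_def)
  ultimately have mem: "vandermonde_map \<alpha> x \<in> Pair 1 -` interior (moments \<alpha> ` T)" by simp
  show ?thesis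
  proof (rule interiorI[OF _ mem])
    show "open (Pair 1 -` interior (moments \<alpha> ` T))"
      by (intro open_vimage open_interior continuous_intros)
    show "Pair 1 -` interior (moments \<alpha> ` T) \<subseteq> vandermonde_map \<alpha> ` (std_simplex :: (real ^ 'n) set)"
    proof
      fix v assume "v \<in> Pair 1 -` interior (moments \<alpha> ` T)"
      then have "(1, v) \<in> moments \<alpha> ` T" using interior_subset by auto
      then obtain u where "u \<in> T" "(1, v) = moments \<alpha> u" by blast
      then show "v \<in> vandermonde_map \<alpha> ` (std_simplex :: (real ^ 'n) set)"
        by (intro image_eqI[of _ _ u]) (auto simp: moments_def T_def std_simplex_def less_imp_le)
    qed
  qed
qed

text \<open>Moving \<open>x\<close> slightly towards a point of the simplex with distinct positive coordinates makes the
  coordinates of \<open>x\<close> distinct and positive.\<close>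

lemma interior_dense:
  fixes \<alpha> :: "'m::finite \<Rightarrow> nat"
  assumes \<alpha>: "inj \<alpha>" "\<And>j. 1 < \<alpha> j" and card: "CARD('m) < CARD('n::finite)"
    and z: "z \<in> vandermonde_map \<alpha> ` (std_simplex :: (real ^ 'n) set)" and e: "0 < e"
  shows "\<exists>v \<in> interior (vandermonde_map \<alpha> ` (std_simplex :: (real ^ 'n) set)). dist v z < e"
proof -
  obtain x :: "real ^ 'n" where x: "x \<in> std_simplex" "z = vandermonde_map \<alpha> x" using z by blast
  obtain g :: "'n \<Rightarrow> nat" where g: "inj g"
    using finite_imp_inj_to_nat_seg[of "UNIV :: 'n set"] by auto
  define s where "s = (\<Sum>i\<in>UNIV. real (g i) + 1)"
  have s: "0 < s" unfolding s_def by (intro sum_pos) auto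
  \<comment> \<open>Any injective numbering of the coordinates gives distinct positive entries; \<open>s\<close> normalises their sum.\<close>
  define c :: "real ^ 'n" where "c = (\<chi> i. (real (g i) + 1) / s)"
  have c: "0 < c $ i" for i using s by (simp add: c_def add_nonneg_pos)
  have cs: "(\<Sum>i\<in>UNIV. c $ i) = 1"
    using s by (simp add: c_def sum_divide_distrib[symmetric] s_def[symmetric])
  have c_inj: "i \<noteq> k \<Longrightarrow> c $ i \<noteq> c $ k" for i k
    using s g by (auto simp: c_def inj_eq)
  define X where "X \<epsilon> = (1 - \<epsilon>) *\<^sub>R x + \<epsilon> *\<^sub>R c" for \<epsilon>
  have X0: "(X \<longlongrightarrow> x) (at_right 0)"
  proof -
    have "((\<lambda>\<epsilon>. (1 - \<epsilon>) *\<^sub>R x + \<epsilon> *\<^sub>R c) \<longlongrightarrow> (1 - 0) *\<^sub>R x + 0 *\<^sub>R c) (at_right 0)"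
      by (intro tendsto_intros)
    then show ?thesis by (simp add: X_def[abs_def])
  qed
  have "\<forall>\<^sub>F \<epsilon> in at_right 0. X \<epsilon> $ i \<noteq> X \<epsilon> $ k" if "i \<noteq> k" for i k
  proof (cases "x $ i = x $ k")
    case True
    then have "X \<epsilon> $ i \<noteq> X \<epsilon> $ k" if "0 < \<epsilon>" for \<epsilon>
      using that c_inj[OF \<open>i \<noteq> k\<close>] by (simp add: X_def)
    then show ?thesis by (simp add: eventually_at_right_less eventually_mono[OF eventually_at_right_less])
  next
    case False
    have "((\<lambda>\<epsilon>. X \<epsilon> $ i - X \<epsilon> $ k) \<longlongrightarrow> x $ i - x $ k) (at_right 0)"
      by (intro tendsto_intros X0)
    then have "\<forall>\<^sub>F \<epsilon> in at_right 0. X \<epsilon> $ i - X \<epsilon> $ k \<noteq> 0"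
      by (rule tendsto_imp_eventually_ne) (use False in simp)
    then show ?thesis by (rule eventually_mono) simp
  qed
  then have "\<forall>\<^sub>F \<epsilon> in at_right 0. \<forall>i k. i \<noteq> k \<longrightarrow> X \<epsilon> $ i \<noteq> X \<epsilon> $ k"
    by (simp add: eventually_all_finite)
  moreover have "\<forall>\<^sub>F \<epsilon> in at_right 0. dist (vandermonde_map \<alpha> (X \<epsilon>)) z < e"
  proof -
    have "isCont (vandermonde_map \<alpha>) x"
      using continuous_on_vandermonde_map[of "UNIV :: (real ^ 'n) set" \<alpha>]
      by (simp add: continuous_on_eq_continuous_at)
    then have "((\<lambda>\<epsilon>. vandermonde_map \<alpha> (X \<epsilon>)) \<longlongrightarrow> z) (at_right 0)"
      unfolding x(2) using X0 by (rule isCont_tendsto_compose)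
    then show ?thesis using e by (rule tendstoD)
  qed
  moreover have "\<forall>\<^sub>F \<epsilon> in at_right 0. 0 < \<epsilon> \<and> \<epsilon> < (1::real)"
    unfolding eventually_at_right_field by (intro exI[of _ 1]) auto
  ultimately have "\<forall>\<^sub>F \<epsilon> in at_right 0. (\<forall>i k. i \<noteq> k \<longrightarrow> X \<epsilon> $ i \<noteq> X \<epsilon> $ k) \<and>
      dist (vandermonde_map \<alpha> (X \<epsilon>)) z < e \<and> 0 < \<epsilon> \<and> \<epsilon> < 1"
    by eventually_elim simp
  then obtain \<epsilon> where \<epsilon>: "\<And>i k. i \<noteq> k \<Longrightarrow> X \<epsilon> $ i \<noteq> X \<epsilon> $ k"
      "dist (vandermonde_map \<alpha> (X \<epsilon>)) z < e" "0 < \<epsilon>" "\<epsilon> < 1"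
    by (auto dest!: eventually_happens simp: trivial_limit_at_right_real)
  have pos: "0 < X \<epsilon> $ i" for i
    using \<epsilon>(3,4) c[of i] std_simplex_nonneg[OF x(1), of i]
    by (simp add: X_def add_nonneg_pos)
  have "(\<Sum>i\<in>UNIV. X \<epsilon> $ i) = (1 - \<epsilon>) * (\<Sum>i\<in>UNIV. x $ i) + \<epsilon> * (\<Sum>i\<in>UNIV. c $ i)"
    by (simp add: X_def sum.distrib sum_distrib_left)
  also have "\<dots> = 1" using x(1) cs by (simp add: std_simplex_def)
  finally have "X \<epsilon> \<in> std_simplex" using pos by (simp add: std_simplex_def less_imp_le)
  then have "vandermonde_map \<alpha> (X \<epsilon>) \<in> interior (vandermonde_map \<alpha> ` (std_simplex :: (real ^ 'n) set))"
    using distinct_positive_imp_interior[OF \<alpha> card _ pos] \<epsilon>(1) by (auto simp: inj_def)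
  with \<epsilon>(2) show ?thesis by blast
qed

section \<open>Points nearest to an exterior point\<close>

text \<open>Mass \<open>s\<close> moves from a coordinate with value \<open>X\<close> to one with value \<open>Y\<close>, and the sum of squares is the
  squared distance of the power sums to a given point. The two claims are the first-order condition
  and, for \<open>X = Y\<close> where the first derivative vanishes, the second-order condition for a minimum at
  \<open>s = 0\<close>. For \<open>X = Y\<close> the derivative of each base vanishes at \<open>0\<close>, so that the second derivative of the
  sum is linear in the bases.\<close>

lemma sum_of_squares_two_point_variation:
  fixes K w :: "'m::finite \<Rightarrow> real" and X Y :: real
  assumes X: "0 < X"
    and min: "\<And>s. 0 \<le> s \<Longrightarrow> s \<le> X \<Longrightarrow>
      (\<Sum>j\<in>UNIV. (K j + X ^ \<alpha> j + Y ^ \<alpha> j)\<^sup>2) \<le> (\<Sum>j\<in>UNIV. (K j + (X - s) ^ \<alpha> j + (Y + s) ^ \<alpha> j)\<^sup>2)"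
  shows "(\<Sum>j\<in>UNIV. (K j + X ^ \<alpha> j + Y ^ \<alpha> j) * (real (\<alpha> j) * X ^ (\<alpha> j - 1)))
      \<le> (\<Sum>j\<in>UNIV. (K j + X ^ \<alpha> j + Y ^ \<alpha> j) * (real (\<alpha> j) * Y ^ (\<alpha> j - 1)))" (is ?first)
    and "X = Y \<Longrightarrow> 0 \<le> (\<Sum>j\<in>UNIV. (K j + X ^ \<alpha> j + Y ^ \<alpha> j) * (real (\<alpha> j) * real (\<alpha> j - 1) * X ^ (\<alpha> j - 2)))"
proof -
  define p where "p j s = K j + (X - s) ^ \<alpha> j + (Y + s) ^ \<alpha> j" for j s
  define p' where "p' j s = real (\<alpha> j) * (Y + s) ^ (\<alpha> j - 1) - real (\<alpha> j) * (X - s) ^ (\<alpha> j - 1)" for j s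
  define p'' where "p'' j s = real (\<alpha> j) * (real (\<alpha> j - 1) * (Y + s) ^ (\<alpha> j - 2)) +
      real (\<alpha> j) * (real (\<alpha> j - 1) * (X - s) ^ (\<alpha> j - 2))" for j s
  have p: "(p j has_real_derivative p' j s) (at s)" for j s
    unfolding p_def[abs_def] p'_def by (auto intro!: derivative_eq_intros)
  have p': "(p' j has_real_derivative p'' j s) (at s)" for j s
    unfolding p'_def[abs_def] p''_def
    by (auto intro!: derivative_eq_intros simp: numeral_2_eq_2)
  define \<phi> where "\<phi> s = (\<Sum>j\<in>UNIV. (p j s)\<^sup>2)" for s
  define \<psi> where "\<psi> s = (\<Sum>j\<in>UNIV. 2 * p j s * p' j s)" for s
  have \<phi>: "(\<phi> has_real_derivative \<psi> s) (at s)" for s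
    unfolding \<phi>_def[abs_def] \<psi>_def by (auto intro!: derivative_eq_intros p sum.cong simp: mult_ac)
  have \<psi>: "(\<psi> has_real_derivative (\<Sum>j\<in>UNIV. 2 * (p' j s * p' j s + p j s * p'' j s))) (at s)" for s
    unfolding \<psi>_def[abs_def] by (auto intro!: derivative_eq_intros p p' sum.cong simp: algebra_simps)
  have \<phi>min: "\<phi> 0 \<le> \<phi> s" if "0 \<le> s" "s \<le> X" for s
    using min[OF that] by (simp add: \<phi>_def p_def)
  have "0 \<le> \<psi> 0"
  proof (rule ccontr)
    assume "\<not> 0 \<le> \<psi> 0"
    then obtain d where d: "d > 0" "\<And>h. 0 < h \<Longrightarrow> h < d \<Longrightarrow> \<phi> (0 + h) < \<phi> 0"
      using DERIV_neg_dec_right[OF \<phi>[of 0]] by auto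
    define h where "h = min (d/2) X"
    have "0 < h" "h < d" "h \<le> X" using d(1) X by (auto simp: h_def)
    with d(2)[of h] \<phi>min[of h] show False by simp
  qed
  moreover have "\<psi> 0 = 2 * ((\<Sum>j\<in>UNIV. (K j + X ^ \<alpha> j + Y ^ \<alpha> j) * (real (\<alpha> j) * Y ^ (\<alpha> j - 1))) -
      (\<Sum>j\<in>UNIV. (K j + X ^ \<alpha> j + Y ^ \<alpha> j) * (real (\<alpha> j) * X ^ (\<alpha> j - 1))))"
    unfolding \<psi>_def sum_subtractf[symmetric] sum_distrib_left
    by (intro sum.cong refl) (simp add: p_def p'_def algebra_simps)
  ultimately show ?first by simp
  show "0 \<le> (\<Sum>j\<in>UNIV. (K j + X ^ \<alpha> j + Y ^ \<alpha> j) * (real (\<alpha> j) * real (\<alpha> j - 1) * X ^ (\<alpha> j - 2)))"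
    (is "0 \<le> ?A") if XY: "X = Y"
  proof (rule ccontr)
    assume "\<not> 0 \<le> ?A"
    moreover have "(\<Sum>j\<in>UNIV. 2 * (p' j 0 * p' j 0 + p j 0 * p'' j 0)) = 4 * ?A"
      unfolding sum_distrib_left
      by (intro sum.cong refl) (simp add: p_def p'_def p''_def XY algebra_simps)
    ultimately have "(\<Sum>j\<in>UNIV. 2 * (p' j 0 * p' j 0 + p j 0 * p'' j 0)) < 0" by simp
    then obtain d where d: "d > 0" "\<And>h. 0 < h \<Longrightarrow> h < d \<Longrightarrow> \<psi> (0 + h) < \<psi> 0"
      using DERIV_neg_dec_right[OF \<psi>[of 0]] by auto
    have \<psi>0: "\<psi> 0 = 0" by (simp add: \<psi>_def p'_def XY)
    define h where "h = min (d/2) X"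
    have h: "0 < h" "h < d" "h \<le> X" using d(1) X by (auto simp: h_def)
    obtain \<xi> where "0 < \<xi>" "\<xi> < h" "\<phi> h - \<phi> 0 = (h - 0) * \<psi> \<xi>"
      using MVT2[OF h(1) \<phi>] by blast
    moreover from this have "\<psi> \<xi> < 0" using d(2)[of \<xi>] h \<psi>0 by simp
    ultimately have "\<phi> h < \<phi> 0" using h(1) mult_pos_neg[of h "\<psi> \<xi>"] by simp
    with \<phi>min[of h] h show False by simp
  qed
qed

text \<open>The first component \<open>\<mu>\<close> of \<open>q\<close> is arbitrary: it cancels in the comparison of two velocities and
  is multiplied by zero in the acceleration. It serves later as the Lagrange multiplier for the
  constraint on the sum of the coordinates.\<close>

lemma nearest_point_conditions:
  fixes x :: "real ^ 'n::finite" and \<alpha> :: "'m::finite \<Rightarrow> nat"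
  assumes x: "x \<in> std_simplex"
    and nearest: "\<And>x' :: real ^ 'n. x' \<in> std_simplex \<Longrightarrow> dist w (vandermonde_map \<alpha> x) \<le> dist w (vandermonde_map \<alpha> x')"
    and ab: "a \<noteq> b" "0 < x $ a"
  defines "q \<equiv> (\<lambda>\<mu>. (\<mu>, vandermonde_map \<alpha> x - w))"
  shows "q \<mu> \<bullet> velocity \<alpha> (x $ a) \<le> q \<mu> \<bullet> velocity \<alpha> (x $ b)"
    and "x $ a = x $ b \<Longrightarrow> 0 \<le> q \<mu> \<bullet> acceleration \<alpha> (x $ a)"
proof -
  define K where "K j = power_sum (\<alpha> j) x - x $ a ^ \<alpha> j - x $ b ^ \<alpha> j - w $ j" for j
  define X where "X s = (\<chi> i. if i = a then x $ a - s else if i = b then x $ b + s else x $ i)" for s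
  have split: "(\<Sum>i\<in>UNIV. f i) = f a + f b + (\<Sum>i\<in>UNIV - {a, b}. f i)" for f :: "'n \<Rightarrow> real"
    using ab(1) by (subst sum.subset_diff[of "{a, b}"]) auto
  have rest: "(\<Sum>i\<in>UNIV - {a, b}. f (X s $ i)) = (\<Sum>i\<in>UNIV - {a, b}. f (x $ i))" for f :: "real \<Rightarrow> real" and s
    by (intro sum.cong) (auto simp: X_def)
  have sumX: "(\<Sum>i\<in>UNIV. f (X s $ i)) = (\<Sum>i\<in>UNIV. f (x $ i)) - f (x $ a) - f (x $ b) + f (x $ a - s) + f (x $ b + s)"
    for f :: "real \<Rightarrow> real" and s
    unfolding split[of "\<lambda>i. f (X s $ i)"] split[of "\<lambda>i. f (x $ i)"] rest using ab(1) by (simp add: X_def)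
  have mem: "X s \<in> std_simplex" if "0 \<le> s" "s \<le> x $ a" for s
    using that x sumX[of "\<lambda>t. t" s] by (auto simp: std_simplex_def X_def)
  have dist: "(dist w (vandermonde_map \<alpha> (X s)))\<^sup>2 = (\<Sum>j\<in>UNIV. (K j + (x $ a - s) ^ \<alpha> j + (x $ b + s) ^ \<alpha> j)\<^sup>2)" for s
  proof -
    have "(dist w (vandermonde_map \<alpha> (X s)))\<^sup>2 = (\<Sum>j\<in>UNIV. (w $ j - power_sum (\<alpha> j) (X s))\<^sup>2)"
      by (simp add: dist_norm norm_vec_def L2_set_def sum_nonneg vandermonde_map_def)
    also have "\<dots> = (\<Sum>j\<in>UNIV. (K j + (x $ a - s) ^ \<alpha> j + (x $ b + s) ^ \<alpha> j)\<^sup>2)"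
    proof (intro sum.cong refl)
      fix j
      have "power_sum (\<alpha> j) (X s) - w $ j = K j + (x $ a - s) ^ \<alpha> j + (x $ b + s) ^ \<alpha> j"
        unfolding K_def power_sum_def using sumX[of "\<lambda>t. t ^ \<alpha> j" s] by simp
      then show "(w $ j - power_sum (\<alpha> j) (X s))\<^sup>2 = (K j + (x $ a - s) ^ \<alpha> j + (x $ b + s) ^ \<alpha> j)\<^sup>2"
        by (metis power2_commute)
    qed
    finally show ?thesis .
  qed
  have X0: "X 0 = x" by (simp add: X_def vec_eq_iff)
  have min: "(\<Sum>j\<in>UNIV. (K j + x $ a ^ \<alpha> j + x $ b ^ \<alpha> j)\<^sup>2) \<le>
      (\<Sum>j\<in>UNIV. (K j + (x $ a - s) ^ \<alpha> j + (x $ b + s) ^ \<alpha> j)\<^sup>2)" if "0 \<le> s" "s \<le> x $ a" for s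
    using power_mono[OF nearest[of "X s", OF mem[OF that]] zero_le_dist, of 2] dist[of s] dist[of 0] X0 by simp
  have snd: "snd (q \<mu>) $ j = K j + x $ a ^ \<alpha> j + x $ b ^ \<alpha> j" for j
    by (simp add: q_def K_def vandermonde_map_def)
  show "q \<mu> \<bullet> velocity \<alpha> (x $ a) \<le> q \<mu> \<bullet> velocity \<alpha> (x $ b)"
    unfolding inner_velocity snd using sum_of_squares_two_point_variation(1)[OF ab(2) min] by (simp add: mult.assoc)
  show "0 \<le> q \<mu> \<bullet> acceleration \<alpha> (x $ a)" if "x $ a = x $ b"
    unfolding inner_acceleration snd using sum_of_squares_two_point_variation(2)[OF ab(2) min that] by (simp add: mult.assoc)
qed

lemma card_pos_values_above_level:
  assumes "\<And>i. 0 \<le> x $ i" "e \<le> mult_length x"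
  shows "card {u \<in> pos_values x. levels x ! e < u} = mult_length x - e"
proof -
  have "{u \<in> pos_values x. levels x ! e < u} = (\<lambda>f. levels x ! f) ` {e<..mult_length x}"
  proof (intro equalityI subsetI)
    fix u assume u: "u \<in> {u \<in> pos_values x. levels x ! e < u}"
    then obtain f where "f \<le> mult_length x" "u = levels x ! f"
      by (auto simp: pos_values_def intro: coordinate_is_level[OF assms(1)])
    then show "u \<in> (\<lambda>f. levels x ! f) ` {e<..mult_length x}"
      using u assms(2) levels_less_iff[of e x f] by auto
  next
    fix u assume "u \<in> (\<lambda>f. levels x ! f) ` {e<..mult_length x}"
    then obtain f where f: "e < f" "f \<le> mult_length x" "u = levels x ! f" by auto
    have "u \<in> set (levels x)" using f by (auto simp: length_levels)
    moreover have "0 < u" using levels_less[of 0 f x] f by simp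
    ultimately show "u \<in> {u \<in> pos_values x. levels x ! e < u}"
      using levels_less[OF f(1,2)] f(3) by (auto simp: set_levels)
  qed
  moreover have "inj_on (\<lambda>f. levels x ! f) {e<..mult_length x}"
    using levels_less by (intro linorder_inj_onI) (fastforce simp: less_imp_neq)+
  ultimately show ?thesis by (simp add: card_image)
qed

text \<open>Without the constant component one of the powers is missing, and with it one zero.\<close>

lemma homogeneous_velocity_few_zeros:
  fixes \<alpha> :: "'m::finite \<Rightarrow> nat"
  assumes "inj \<alpha>" "\<And>j. 1 < \<alpha> j" "q \<noteq> 0" "fst q = 0" "finite Z"
    and "\<And>z. z \<in> Z \<Longrightarrow> 0 < z \<and> q \<bullet> velocity \<alpha> z = 0"
  shows "card Z < CARD('m)"
proof (rule ccontr)
  assume *: "\<not> card Z < CARD('m)"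
  have "\<forall>j\<in>UNIV. snd q $ j * real (\<alpha> j) = 0"
  proof (rule powr_sum_zeros_imp_zero[where b="\<lambda>j. real (\<alpha> j - 1)" and Z=Z])
    show "inj (\<lambda>j. real (\<alpha> j - 1))"
    proof (rule injI)
      fix i j assume "real (\<alpha> i - 1) = real (\<alpha> j - 1)"
      then have "\<alpha> i = \<alpha> j" using assms(2)[of i] assms(2)[of j] by simp
      then show "i = j" using assms(1) by (simp add: inj_eq)
    qed
    show "0 < z \<and> (\<Sum>j\<in>UNIV. snd q $ j * real (\<alpha> j) * z powr real (\<alpha> j - 1)) = 0"
      if "z \<in> Z" for z
      using assms(4) assms(6)[OF that] by (simp add: inner_velocity powr_realpow)
  qed (use * assms in auto)
  then have "snd q $ j = 0" for j using assms(2)[of j] by auto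
  then show False using assms(3,4) by (simp add: vec_eq_iff prod_eq_iff)
qed

text \<open>With the multiplier chosen so that the combination \<open>q \<bullet> velocity \<alpha>\<close> vanishes at one positive
  coordinate, it vanishes at all of them. When there are \<open>k\<close> of them, its derivative alternates along
  them, and it is negative at the levels of one parity; these are simple by the second-order
  condition. If the parity is even, then the combination is nonpositive near \<open>0\<close>. A zero coordinate
  would force it to be nonnegative at \<open>0\<close> by the first-order condition, so that its constant component
  would vanish, which leaves only \<open>k - 1\<close> positive zeros. Hence the point is then of type (2).\<close>

lemma nearest_point_type:
  fixes x :: "real ^ 'n::finite" and \<alpha> :: "'m::finite \<Rightarrow> nat"
  assumes \<alpha>: "inj \<alpha>" "\<And>j. 1 < \<alpha> j" and x: "x \<in> std_simplex" and w: "w \<noteq> vandermonde_map \<alpha> x"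
    and nearest: "\<And>x' :: real ^ 'n. x' \<in> std_simplex \<Longrightarrow> dist w (vandermonde_map \<alpha> x) \<le> dist w (vandermonde_map \<alpha> x')"
    and long: "CARD('m) \<le> mult_length x"
  shows "mult_length x = CARD('m)" "type_1 x \<or> type_2 x"
proof -
  have xnn: "0 \<le> x $ i" for i using std_simplex_nonneg[OF x] .
  have "\<exists>i. 0 < x $ i"
  proof (rule ccontr)
    assume "\<nexists>i. 0 < x $ i"
    then have "x $ i = 0" for i using xnn[of i] by (metis order_less_le)
    then show False using x by (simp add: std_simplex_def)
  qed
  then obtain i0 where i0: "0 < x $ i0" by blast
  define q where "q = (- ((0, vandermonde_map \<alpha> x - w) \<bullet> velocity \<alpha> (x $ i0)), vandermonde_map \<alpha> x - w)"
  have q0: "q \<noteq> 0" using w by (auto simp: q_def prod_eq_iff)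
  have first: "q \<bullet> velocity \<alpha> (x $ a) \<le> q \<bullet> velocity \<alpha> (x $ b)" if "0 < x $ a" for a b
    using nearest_point_conditions(1)[OF x nearest _ that, of b] unfolding q_def by (cases "a = b") auto
  have second: "0 \<le> q \<bullet> acceleration \<alpha> (x $ a)" if "0 < x $ a" "x $ a = x $ b" "a \<noteq> b" for a b
    using nearest_point_conditions(2)[OF x nearest that(3,1,2)] unfolding q_def by auto
  have i0_zero: "q \<bullet> velocity \<alpha> (x $ i0) = 0"
    by (simp add: q_def inner_velocity)
  have zero: "0 < z \<and> q \<bullet> velocity \<alpha> z = 0" if z: "z \<in> pos_values x" for z
  proof -
    obtain i where i: "x $ i = z" "0 < x $ i" using z by (auto simp: pos_values_def)
    show ?thesis using first[OF i(2), of i0] first[OF i0, of i] i i0_zero by simp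
  qed
  have "mult_length x \<le> CARD('m)"
    unfolding mult_length_def by (rule velocity_few_zeros[OF \<alpha> q0 finite_pos_values zero])
  with long show len: "mult_length x = CARD('m)" by simp
  then have card: "card (pos_values x) = CARD('m)" by (simp add: mult_length_def)
  obtain \<sigma> :: real where \<sigma>: "\<sigma> = 1 \<or> \<sigma> = -1"
    "\<And>t. 0 < t \<Longrightarrow> 0 \<le> \<sigma> * (-1) ^ card {z\<in>pos_values x. t < z} * (q \<bullet> velocity \<alpha> t)"
    "\<And>z. z \<in> pos_values x \<Longrightarrow> 0 < \<sigma> * (-1) ^ card {u\<in>pos_values x. z < u} * (q \<bullet> acceleration \<alpha> z)"
    by (rule velocity_sign_pattern[OF \<alpha> q0 finite_pos_values card zero], assumption) (rule that)
  have simple: "card {k. x $ k = levels x ! e} = 1"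
    if e: "1 \<le> e" "e \<le> mult_length x" and neg: "\<sigma> * (-1) ^ (mult_length x - e) = -1" for e
  proof -
    define v where "v = levels x ! e"
    have "v \<in> set (levels x)" using e by (simp add: v_def length_levels)
    moreover have "0 < v" using levels_less[of 0 e x] e by (simp add: v_def)
    ultimately have v: "v \<in> pos_values x" by (auto simp: set_levels)
    then obtain a where a: "x $ a = v" "0 < v" by (auto simp: pos_values_def)
    have "q \<bullet> acceleration \<alpha> v < 0"
      using \<sigma>(3)[OF v] card_pos_values_above_level[of x e, OF xnn e(2)] neg by (simp add: v_def)
    then have "b = a" if "x $ b = v" for b
      using second[of a b] a that by fastforce
    then have "{k. x $ k = v} = {a}" using a by blast
    then show ?thesis by (simp add: v_def)
  qed
  have mv: "e \<le> mult_length x \<Longrightarrow> mult_vector x ! e = card {k. x $ k = levels x ! e}" for e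
    by (rule mult_vector_nth)
  have ge1: "1 \<le> card {k. x $ k = levels x ! e}" if e: "1 \<le> e" "e \<le> mult_length x" for e
  proof -
    have "levels x ! e \<in> set (levels x)" using e by (simp add: length_levels)
    moreover have "0 < levels x ! e" using levels_less[of 0 e x] e by simp
    ultimately have "{k. x $ k = levels x ! e} \<noteq> {}" by (auto simp: set_levels pos_values_def)
    then show ?thesis by (simp add: Suc_le_eq card_gt_0_iff)
  qed
  \<comment> \<open>In the first case the derivative is negative at the odd levels, in the second at the even ones.\<close>
  consider "\<sigma> * (-1) ^ mult_length x = 1" | "\<sigma> * (-1) ^ mult_length x = -1"
    using \<sigma>(1) by (cases "even (mult_length x)") auto
  then show "type_1 x \<or> type_2 x"
  proof cases
    case 1
    have "card {k. x $ k = levels x ! e} = 1" if "1 \<le> e" "e \<le> mult_length x" "odd e" for e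
      using that 1 by (intro simple) (auto simp: minus_one_power_iff split: if_splits)
    then have "type_1 x"
      unfolding type_1_def using mv ge1 by (intro conjI allI impI) auto
    then show ?thesis ..
  next
    case 2
    have even: "card {k. x $ k = levels x ! e} = 1" if "1 \<le> e" "e \<le> mult_length x" "even e" for e
      using that 2 by (intro simple) (auto simp: minus_one_power_iff split: if_splits)
    have "x $ b \<noteq> 0" for b
    proof
      assume b: "x $ b = 0"
      have at0: "q \<bullet> velocity \<alpha> 0 = fst q"
      proof -
        have "(0::real) ^ (\<alpha> j - 1) = 0" for j using \<alpha>(2)[of j] by simp
        then show ?thesis
          unfolding inner_velocity by (simp only: mult_zero_right sum.neutral_const add_0_right)
      qed
      have "0 \<le> fst q" using first[OF i0, of b] i0_zero b at0 by simp
      moreover have "fst q \<le> 0"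
      proof -
        define m where "m = Min (pos_values x)"
        have ne: "pos_values x \<noteq> {}" using i0 by (auto simp: pos_values_def)
        have m: "m \<in> pos_values x" "0 < m" "\<And>z. z \<in> pos_values x \<Longrightarrow> m \<le> z"
          using ne zero by (auto simp: m_def)
        have "q \<bullet> velocity \<alpha> t \<le> 0" if t: "0 < t" "t < m" for t
        proof -
          have "{z\<in>pos_values x. t < z} = pos_values x" using m(3) t by force
          then show ?thesis using \<sigma>(2)[OF t(1)] 2 by (simp add: mult_length_def)
        qed
        then have "\<forall>\<^sub>F t in at_right 0. q \<bullet> velocity \<alpha> t \<le> 0"
          unfolding eventually_at_right_field using m(2) by blast
        moreover have "((\<lambda>t. q \<bullet> velocity \<alpha> t) \<longlongrightarrow> q \<bullet> velocity \<alpha> 0) (at_right 0)"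
          using continuous_velocity[of \<alpha>]
          by (intro tendsto_intros) (metis UNIV_I at_within_open continuous_on_def filterlim_at_split open_UNIV)
        ultimately show ?thesis unfolding at0 by (intro tendsto_upperbound) auto
      qed
      ultimately have "fst q = 0" by simp
      then have "card (pos_values x) < CARD('m)"
        by (intro homogeneous_velocity_few_zeros[OF \<alpha> q0 _ finite_pos_values zero])
      with card show False by simp
    qed
    then have "type_2 x"
      unfolding type_2_def using mv mv[of 0] ge1 even by (intro conjI allI impI) auto
    then show ?thesis ..
  qed
qed

section \<open>Points of smaller multiplicity length\<close>

text \<open>The argument only names the index type, whose cardinality bounds the multiplicity length.\<close>

definition short_points :: "'m::finite itself \<Rightarrow> (real ^ 'n::finite) set" where
  "short_points _ = {x \<in> std_simplex. mult_length x < CARD('m)}"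

definition value_functional :: "('n \<Rightarrow> 'm option) \<Rightarrow> 'n \<Rightarrow> real ^ 'm::finite" where
  "value_functional \<rho> i = (case \<rho> i of None \<Rightarrow> 0 | Some j \<Rightarrow> axis j 1)"

text \<open>The pattern \<open>\<rho>\<close> sends a coordinate to \<open>None\<close> if it vanishes and to the index of its value in \<open>u\<close>
  otherwise. There are finitely many patterns, and for each of them the point depends linearly on
  the values.\<close>

definition patterned :: "('n::finite \<Rightarrow> 'm::finite option) \<Rightarrow> real ^ 'm \<Rightarrow> real ^ 'n" where
  "patterned \<rho> u = (\<chi> i. value_functional \<rho> i \<bullet> u)"

lemma patterned_nth: "patterned \<rho> u $ i = (case \<rho> i of None \<Rightarrow> 0 | Some j \<Rightarrow> u $ j)"
  by (simp add: patterned_def value_functional_def inner_axis' split: option.split)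

lemma linear_patterned: "linear (patterned \<rho>)"
  by (rule linearI) (simp_all add: patterned_def vec_eq_iff inner_add_right)

text \<open>Fewer than \<open>k\<close> values leave one entry of \<open>u\<close> free. This entry, with index \<open>j0\<close>, is available as an
  additional real parameter \<open>r\<close>.\<close>

lemma short_point_patterned:
  fixes x :: "real ^ 'n::finite" and j0 :: "'m::finite"
  assumes "x \<in> short_points TYPE('m)"
  shows "\<exists>\<rho> u. (\<forall>i. \<rho> i \<noteq> Some j0) \<and> u $ j0 = r \<and> x = patterned \<rho> u"
proof -
  have x: "\<And>i. 0 \<le> x $ i" "card (pos_values x) < CARD('m)"
    using assms by (auto simp: short_points_def std_simplex_nonneg mult_length_def)
  have "card (pos_values x) \<le> card (UNIV - {j0})" using x(2) by simp
  then obtain h where h: "inj_on h (pos_values x)" "h ` pos_values x \<subseteq> UNIV - {j0}"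
    using card_le_inj[OF finite_pos_values, of "UNIV - {j0}" x] by auto
  define \<rho> where "\<rho> i = (if x $ i = 0 then None else Some (h (x $ i)))" for i
  define u :: "real ^ 'm" where "u = (\<chi> j. if j = j0 then r else inv_into (pos_values x) h j)"
  have pos: "x $ i \<in> pos_values x" if "x $ i \<noteq> 0" for i
    using that x(1)[of i] by (auto simp: pos_values_def)
  have hne: "h (x $ i) \<noteq> j0" if "x $ i \<noteq> 0" for i using pos[OF that] h(2) by blast
  have "x $ i = patterned \<rho> u $ i" for i
    using hne[of i] pos[of i] h(1) by (simp add: patterned_nth \<rho>_def u_def inv_into_f_f)
  moreover have "\<forall>i. \<rho> i \<noteq> Some j0" using hne by (auto simp: \<rho>_def)
  ultimately show ?thesis
    by (intro exI[of _ \<rho>] exI[of _ u]) (auto simp: vec_eq_iff u_def)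
qed

lemma patterned_short_point:
  fixes j0 :: "'m::finite"
  assumes "\<And>i. \<rho> i \<noteq> Some j0" "patterned \<rho> u \<in> std_simplex"
  shows "patterned \<rho> u \<in> short_points TYPE('m)"
proof -
  have "v \<in> (\<lambda>j. u $ j) ` (UNIV - {j0})" if v: "v \<in> pos_values (patterned \<rho> u)" for v
  proof -
    obtain i where "patterned \<rho> u $ i = v" "0 < v" using v by (auto simp: pos_values_def)
    then obtain j where "\<rho> i = Some j" "v = u $ j" by (auto simp: patterned_nth split: option.splits)
    then show ?thesis using assms(1)[of i] by auto
  qed
  then have "card (pos_values (patterned \<rho> u)) \<le> card ((\<lambda>j. u $ j) ` (UNIV - {j0}))"
    by (intro card_mono) auto
  also have "\<dots> \<le> card (UNIV - {j0})" by (rule card_image_le) simp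
  also have "\<dots> < CARD('m)" by (rule psubset_card_mono) auto
  finally show ?thesis using assms(2) by (simp add: short_points_def mult_length_def)
qed

lemma compact_short_points: "compact (short_points TYPE('m::finite) :: (real ^ 'n::finite) set)"
proof -
  define j0 :: 'm where "j0 = undefined"
  have "short_points TYPE('m) = (std_simplex :: (real ^ 'n) set) \<inter>
    (\<Union>\<rho>\<in>{\<rho>. \<forall>i. \<rho> i \<noteq> Some j0}. range (patterned \<rho>))" (is "?L = ?R")
  proof (intro equalityI subsetI)
    fix x :: "real ^ 'n" assume x: "x \<in> ?L"
    then have "x \<in> std_simplex" by (simp add: short_points_def)
    then show "x \<in> ?R" using short_point_patterned[OF x, of j0 0] by blast
  next
    fix x assume "x \<in> ?R"
    then obtain \<rho> u where "\<And>i. \<rho> i \<noteq> Some j0" "x = patterned \<rho> u" "x \<in> std_simplex" by blast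
    then show "x \<in> ?L" using patterned_short_point by blast
  qed
  moreover have "closed (range (patterned \<rho> :: real ^ 'm \<Rightarrow> real ^ 'n))" for \<rho>
    by (intro closed_subspace linear_subspace_image linear_patterned subspace_UNIV)
  ultimately show ?thesis
    by (auto intro!: compact_Int_closed[OF compact_std_simplex] closed_UN)
qed

text \<open>The cone with apex \<open>w\<close> is a finite union of differentiable images of hyperplanes in the \<open>k\<close>-dimensional
  space of parameters: \<open>k - 1\<close> entries are values of coordinates, restricted by the condition that the
  coordinates add up to \<open>1\<close>, and the free entry is the scale \<open>r\<close>.\<close>

lemma negligible_cone_over_short_points:
  fixes \<alpha> :: "'m::finite \<Rightarrow> nat" and w :: "real ^ 'm"
  shows "negligible {w + r *\<^sub>R (vandermonde_map \<alpha> x - w) | r x. x \<in> (short_points TYPE('m) :: (real ^ 'n::finite) set)}"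
proof -
  define j0 :: 'm where "j0 = undefined"
  define \<Psi> where "\<Psi> \<rho> u = w + u $ j0 *\<^sub>R (vandermonde_map \<alpha> (patterned \<rho> u :: real ^ 'n) - w)" for \<rho> u
  define D where "D \<rho> = {u. (\<Sum>i\<in>(UNIV :: 'n set). patterned \<rho> u $ i) = 1}" for \<rho> :: "'n \<Rightarrow> 'm option"
  have "negligible (D \<rho>)" for \<rho>
  proof -
    have "D \<rho> = {u. (\<Sum>i\<in>UNIV. value_functional \<rho> i) \<bullet> u = 1}"
      by (simp add: D_def patterned_def inner_sum_left)
    then show ?thesis using negligible_hyperplane[of _ 1] by simp
  qed
  moreover have "\<Psi> \<rho> differentiable_on D \<rho>" for \<rho>
  proof (rule differentiable_at_imp_differentiable_on)
    fix u
    have "(\<lambda>u. vandermonde_map \<alpha> (patterned \<rho> u :: real ^ 'n)) differentiable (at u)"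
      using differentiable_chain_at[OF linear_imp_differentiable[OF linear_patterned] vandermonde_map_differentiable]
      by (simp add: o_def)
    moreover have "(\<lambda>u. u $ j0) differentiable (at u)"
      by (intro bounded_linear_imp_differentiable bounded_linear_vec_nth)
    ultimately show "\<Psi> \<rho> differentiable (at u)"
      unfolding \<Psi>_def[abs_def] by (intro differentiable_add differentiable_scaleR differentiable_diff) auto
  qed
  ultimately have "negligible (\<Psi> \<rho> ` D \<rho>)" for \<rho>
    by (intro negligible_differentiable_image_negligible) auto
  then have "negligible (\<Union>\<rho>. \<Psi> \<rho> ` D \<rho>)"
    by (intro negligible_Union) auto
  then show ?thesis
  proof (rule negligible_subset)
    show "{w + r *\<^sub>R (vandermonde_map \<alpha> x - w) | r x. x \<in> (short_points TYPE('m) :: (real ^ 'n::finite) set)}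
      \<subseteq> (\<Union>\<rho>. \<Psi> \<rho> ` D \<rho>)"
    proof clarify
      fix r and x :: "real ^ 'n" assume x: "x \<in> short_points TYPE('m)"
      obtain \<rho> u where u: "u $ j0 = r" "x = patterned \<rho> u" using short_point_patterned[OF x] by metis
      then have "u \<in> D \<rho>" using x by (auto simp: D_def short_points_def std_simplex_def)
      then show "w + r *\<^sub>R (vandermonde_map \<alpha> x - w) \<in> (\<Union>\<rho>. \<Psi> \<rho> ` D \<rho>)"
        using u by (auto simp: \<Psi>_def)
    qed
  qed
qed

section \<open>Every boundary point is a limit of extremal values\<close>

text \<open>Take an exterior point \<open>w\<close> near \<open>z\<close>, and an interior point \<open>v\<close> near \<open>z\<close> off the cone with apex \<open>w\<close>
  over the values of short points. The segment from \<open>w\<close> to \<open>v\<close> crosses the boundary, and a short value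
  on it would put \<open>v\<close> on the cone.\<close>

lemma frontier_avoiding_short_points_dense:
  fixes \<alpha> :: "'m::finite \<Rightarrow> nat"
  assumes \<alpha>: "inj \<alpha>" "\<And>j. 1 < \<alpha> j" and card: "CARD('m) < CARD('n::finite)"
    and z: "z \<in> frontier (vandermonde_map \<alpha> ` (std_simplex :: (real ^ 'n) set))" and e: "0 < e"
  shows "\<exists>p \<in> frontier (vandermonde_map \<alpha> ` (std_simplex :: (real ^ 'n) set)).
    dist p z < e \<and> p \<notin> vandermonde_map \<alpha> ` (short_points TYPE('m) :: (real ^ 'n) set)"
proof -
  let ?P = "vandermonde_map \<alpha> ` (std_simplex :: (real ^ 'n) set)"
  let ?L = "short_points TYPE('m) :: (real ^ 'n) set"
  obtain w where w: "w \<notin> ?P" "dist z w < e"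
    using z e by (auto simp: frontier_straddle)
  have "z \<in> ?P" using z closed_image[of \<alpha>] frontier_subset_closed by blast
  then obtain v0 where "v0 \<in> interior ?P" "dist v0 z < e"
    using interior_dense[OF \<alpha> card _ e] by blast
  then have "interior ?P \<inter> ball z e \<noteq> {}" by (auto simp: dist_commute)
  moreover have "open (interior ?P \<inter> ball z e)" by (intro open_Int open_interior open_ball)
  ultimately have "\<not> negligible (interior ?P \<inter> ball z e)" using open_not_negligible by blast
  moreover define N where "N = {w + r *\<^sub>R (vandermonde_map \<alpha> x - w) | r x. x \<in> ?L}"
  moreover have "negligible N" unfolding N_def by (rule negligible_cone_over_short_points)
  ultimately have "\<not> interior ?P \<inter> ball z e \<subseteq> N" using negligible_subset by metis
  then obtain v where v: "v \<in> interior ?P" "v \<in> ball z e" "v \<notin> N"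
    by (metis IntD1 IntD2 subsetI)
  have "v \<in> ?P" using v(1) interior_subset by blast
  then have "closed_segment w v \<inter> frontier ?P \<noteq> {}"
    using w(1) by (intro connected_Int_frontier) auto
  then obtain p where p: "p \<in> closed_segment w v" "p \<in> frontier ?P" by blast
  have "closed_segment w v \<subseteq> ball z e"
    using w(2) v(2) by (intro closed_segment_subset convex_ball) auto
  with p(1) have "dist p z < e" by (auto simp: dist_commute)
  moreover have "p \<notin> vandermonde_map \<alpha> ` ?L"
  proof
    assume "p \<in> vandermonde_map \<alpha> ` ?L"
    then obtain x where x: "x \<in> ?L" "p = vandermonde_map \<alpha> x" by blast
    obtain u where u: "p = (1 - u) *\<^sub>R w + u *\<^sub>R v" using p(1) by (auto simp: in_segment)
    have "p \<in> ?P" using x by (auto simp: short_points_def)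
    then have "u \<noteq> 0" using u w(1) by auto
    have "p - w = u *\<^sub>R (v - w)" by (simp add: u algebra_simps)
    then have "v = w + (1 / u) *\<^sub>R (p - w)" using \<open>u \<noteq> 0\<close> by simp
    then have "v \<in> N" using x unfolding N_def by blast
    then show False using v(3) by simp
  qed
  ultimately show ?thesis using p(2) by blast
qed

text \<open>Near a boundary point \<open>p\<close> that is not the value of a short point there are exterior points \<open>w\<close>, and
  the point of the image nearest to \<open>w\<close> is so close to \<open>p\<close> that it is no such value either.\<close>

lemma frontier_subset_extremal_closure:
  fixes \<alpha> :: "'m::finite \<Rightarrow> nat"
  assumes \<alpha>: "inj \<alpha>" "\<And>j. 1 < \<alpha> j" and card: "CARD('m) < CARD('n::finite)"
  shows "frontier (vandermonde_map \<alpha> ` (std_simplex :: (real ^ 'n) set)) \<subseteq>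
    closure (vandermonde_map \<alpha> ` {x \<in> (std_simplex :: (real ^ 'n) set).
             mult_length x = CARD('m) \<and> (type_1 x \<or> type_2 x)})"
proof
  let ?P = "vandermonde_map \<alpha> ` (std_simplex :: (real ^ 'n) set)"
  let ?L = "vandermonde_map \<alpha> ` (short_points TYPE('m) :: (real ^ 'n) set)"
  fix z assume z: "z \<in> frontier ?P"
  show "z \<in> closure (vandermonde_map \<alpha> ` {x \<in> (std_simplex :: (real ^ 'n) set).
             mult_length x = CARD('m) \<and> (type_1 x \<or> type_2 x)})"
    unfolding closure_approachable
  proof (intro allI impI)
    fix e :: real assume e: "0 < e"
    then have e2: "0 < e / 2" by simp
    obtain p where p: "p \<in> frontier ?P" "dist p z < e / 2" "p \<notin> ?L"
      using frontier_avoiding_short_points_dense[OF \<alpha> card z e2] by blast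
    have "closed ?L"
      by (intro compact_imp_closed compact_continuous_image continuous_on_vandermonde_map compact_short_points)
    then have "open (- ?L)" by (rule open_Compl)
    then obtain r where r: "0 < r" "ball p r \<subseteq> - ?L" using p(3) open_contains_ball by blast
    define \<delta> where "\<delta> = min r (e / 2) / 2"
    have \<delta>: "0 < \<delta>" "2 * \<delta> \<le> r" "2 * \<delta> \<le> e / 2" using r e by (auto simp: \<delta>_def)
    obtain w where w: "w \<notin> ?P" "dist p w < \<delta>"
      using p(1) \<delta>(1) by (auto simp: frontier_straddle)
    have pP: "p \<in> ?P" using p(1) closed_image[of \<alpha>] frontier_subset_closed by blast
    then obtain y where y: "y \<in> ?P" "\<And>v. v \<in> ?P \<Longrightarrow> dist w y \<le> dist w v"
      using distance_attains_inf[OF closed_image, of \<alpha> w] by blast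
    obtain x :: "real ^ 'n" where x: "x \<in> std_simplex" "y = vandermonde_map \<alpha> x" using y(1) by blast
    have "dist p y < 2 * \<delta>"
      using dist_triangle[of p y w] y(2)[OF pP] w(2) by (simp add: dist_commute)
    then have "y \<in> ball p r" using \<delta>(2) by simp
    then have "y \<notin> ?L" using r(2) by blast
    then have "CARD('m) \<le> mult_length x"
      using x by (auto simp: short_points_def not_less[symmetric])
    moreover have "dist w (vandermonde_map \<alpha> x) \<le> dist w (vandermonde_map \<alpha> x')" if "x' \<in> std_simplex" for x' :: "real ^ 'n"
      using y(2) x(2) that by blast
    moreover have "w \<noteq> vandermonde_map \<alpha> x" using w(1) x(1) by blast
    ultimately have "mult_length x = CARD('m)" "type_1 x \<or> type_2 x"
      using nearest_point_type[OF \<alpha> x(1), of w] by blast+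
    moreover have "dist y z < e"
      using dist_triangle[of y z p] \<open>dist p y < 2 * \<delta>\<close> \<delta>(3) p(2) by (simp add: dist_commute)
    ultimately show "\<exists>v \<in> vandermonde_map \<alpha> ` {x \<in> (std_simplex :: (real ^ 'n) set).
             mult_length x = CARD('m) \<and> (type_1 x \<or> type_2 x)}. dist v z < e"
      using x by blast
  qed
qed

section \<open>The boundary of the image of the simplex\<close>

theorem theorem2p4:
  fixes \<alpha> :: "'m::{finite,linorder} \<Rightarrow> nat"
    and d :: nat
  assumes "2 \<le> d" and "d \<le> CARD('n::finite)" and "CARD('m) = d - 1"
    and "strict_mono \<alpha>" and "\<And>j. 1 < \<alpha> j"
  shows "frontier (vandermonde_map \<alpha> ` (std_simplex :: (real ^ 'n) set)) =
           closure (vandermonde_map \<alpha> ` {x \<in> (std_simplex :: (real ^ 'n) set).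
             mult_length x = d - 1 \<and> (type_1 x \<or> type_2 x)})
       \<and> (\<forall>y \<in> frontier (vandermonde_map \<alpha> ` (std_simplex :: (real ^ 'n) set)).
            \<exists>x \<in> (std_simplex :: (real ^ 'n) set). vandermonde_map \<alpha> x = y \<and>
              (\<forall>x' \<in> std_simplex. vandermonde_map \<alpha> x' = y \<longrightarrow> permuted x x'))"
proof -
  let ?F = "frontier (vandermonde_map \<alpha> ` (std_simplex :: (real ^ 'n) set))"
  let ?E = "vandermonde_map \<alpha> ` {x \<in> (std_simplex :: (real ^ 'n) set).
             mult_length x = CARD('m) \<and> (type_1 x \<or> type_2 x)}"
  have card: "CARD('m) < CARD('n)" using assms(1-3) by simp
  have sub: "?F \<subseteq> closure ?E"
    by (rule frontier_subset_extremal_closure[OF strict_mono_imp_inj_on[OF assms(4)] assms(5) card])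
  moreover have "closure ?E \<subseteq> ?F"
  proof (rule closure_minimal)
    show "?E \<subseteq> ?F" using type_1_or_2_in_frontier[OF assms(4,5)] by blast
  qed (rule frontier_closed)
  ultimately have "?F = closure ?E" by blast
  moreover have "\<forall>y\<in>?F. \<exists>x \<in> (std_simplex :: (real ^ 'n) set). vandermonde_map \<alpha> x = y \<and>
              (\<forall>x' \<in> std_simplex. vandermonde_map \<alpha> x' = y \<longrightarrow> permuted x x')"
    using extremal_closure_unique_fibre[OF assms(4,5)] sub by blast
  ultimately show ?thesis unfolding assms(3) by blast
qed

end
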